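(* Let $\rho>0$. If $u$ is a positive free pluriharmonic function on the open unit ball with operator-valued coefficients in $B(\mathcal E)$, and $0\le r<1$, then $$u(0)\,\frac{1-r(2\rho-1)}{1+r}\le u(rX_1,\ldots,rX_n)\le u(0)\,\frac{1+r(2\rho-1)}{1-r}$$ for any $(X_1,\ldots,X_n)\in\mathcal C_\rho$.
   Context: Let $n\ge1$, $\mathcal H$ a complex Hilbert space, $\mathcal K$ a separable infinite-dimensional Hilbert space, $\mathcal E$ a separable Hilbert space. $\mathbb F_n^+$ is the unital free semigroup on generators $g_1,\ldots,g_n$ with identity $g_0$; $|\alpha|$ is the length of $\alpha$. $X_\alpha:=X_{i_1}\cdots X_{i_k}$ if $\alpha=g_{i_1}\cdots g_{i_k}$, $X_{g_0}:=I$. $\mathcal C_\rho\subset B(\mathcal H)^n$ is the set of $T$ for which there exist a Hilbert space $\mathcal G\supseteq\mathcal H$ and isometries $V_1,\ldots,V_n\in B(\mathcal G)$ with mutually orthogonal ranges such that $T_\alpha=\rho P_{\mathcal H}V_\alpha|_{\mathcal H}$ for all $\alpha\ne g_0$. The open unit ball is $[B(\mathcal K)^n]_1:=\{X\in B(\mathcal K)^n:\|\sum_iX_iX_i^*\|<1\}$. A free holomorphic function with coefficients in $B(\mathcal E)$ is $F(X)=\sum_{k=0}^\infty\sum_{|\alpha|=k}X_\alpha\otimes A_{(\alpha)}$, with $A_{(\alpha)}\in B(\mathcal E)$ and $\limsup_k\|\sum_{|\alpha|=k}A_{(\alpha)}^*A_{(\alpha)}\|^{1/2k}\le1$. A positive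 free pluriharmonic function is $u=\Re F:=\frac12(F^*+F)$ for a free holomorphic $F$, with $u(X)\ge0$ for all $X\in[B(\mathcal K)^n]_1$; it has the form $u(X)=\sum_{k\ge1}\sum_{|\alpha|=k}X_\alpha^*\otimes A_{(\alpha)}^*+I\otimes A_{(0)}+\sum_{k\ge1}\sum_{|\alpha|=k}X_\alpha\otimes A_{(\alpha)}$. For $X\in\mathcal C_\rho$ and $r\in[0,1)$, $u(rX)$ is the operator on $\mathcal H\otimes\mathcal E$ obtained by substituting $rX$ in this series (norm convergent in $k$), and $u(0)=I_{\mathcal H}\otimes A_{(0)}$. *)

theory Defs
  imports "HOL-Analysis.Analysis"
begin

section \<open>Complex Hilbert spaces and their operators\<close>

text \<open>
  A complex Hilbert space is a complete real inner product space whose scalar multiplication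
  extends to the complex numbers and whose inner product is the real part of a complex one,
  linear in the first argument. The norm and topology are those of the real structure.
\<close>

class chilbert_space = real_inner + complete_space +
  fixes scaleC :: "complex \<Rightarrow> 'a \<Rightarrow> 'a" (infixr "*\<^sub>C" 75)
    and cinner :: "'a \<Rightarrow> 'a \<Rightarrow> complex"
  assumes scaleC_add_right: "c *\<^sub>C (x + y) = c *\<^sub>C x + c *\<^sub>C y"
    and scaleC_add_left: "(c + d) *\<^sub>C x = c *\<^sub>C x + d *\<^sub>C x"
    and scaleC_scaleC: "c *\<^sub>C (d *\<^sub>C x) = (c * d) *\<^sub>C x"
    and scaleC_of_real: "complex_of_real r *\<^sub>C x = r *\<^sub>R x"
    and cinner_commute: "cinner x y = cnj (cinner y x)"
    and cinner_add_left: "cinner (x + y) z = cinner x z + cinner y z"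
    and cinner_scaleC_left: "cinner (c *\<^sub>C x) y = c * cinner x y"
    and inner_eq_Re_cinner: "inner x y = Re (cinner x y)"
begin

subclass banach ..

end

lemma vector_space_scaleC: "vector_space (scaleC :: complex \<Rightarrow> 'a::chilbert_space \<Rightarrow> 'a)"
  by unfold_locales
    (simp_all add: scaleC_add_right scaleC_add_left scaleC_scaleC
      scaleC_of_real [of 1, simplified])

abbreviation cspan :: "'a::chilbert_space set \<Rightarrow> 'a set"
  where "cspan \<equiv> module.span scaleC"

definition infinite_cdim :: "'a::chilbert_space itself \<Rightarrow> bool"
  where "infinite_cdim _ \<longleftrightarrow> (\<forall>S::'a set. finite S \<longrightarrow> cspan S \<noteq> UNIV)"

text \<open>
  The type \<^typ>\<open>'a \<Rightarrow>\<^sub>L 'b\<close> consists of the bounded \<^emph>\<open>real\<close>-linear maps; the set below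
  is the space \<open>B(H, K)\<close> of bounded complex-linear ones. Its norm is the operator norm.
\<close>

definition clinear_ops :: "('a::chilbert_space \<Rightarrow>\<^sub>L 'b::chilbert_space) set"
  where "clinear_ops = {A :: 'a \<Rightarrow>\<^sub>L 'b. \<forall>c x. A (c *\<^sub>C x) = c *\<^sub>C A x}"

definition adj :: "('a::chilbert_space \<Rightarrow>\<^sub>L 'b::chilbert_space) \<Rightarrow> ('b \<Rightarrow>\<^sub>L 'a)"
  where "adj A = (THE B :: 'b \<Rightarrow>\<^sub>L 'a. \<forall>x y. cinner (A x) y = cinner x (B y))"

definition op_le :: "('a::chilbert_space \<Rightarrow>\<^sub>L 'a) \<Rightarrow> ('a \<Rightarrow>\<^sub>L 'a) \<Rightarrow> bool"
  where "op_le A B \<longleftrightarrow> (\<forall>x. cinner ((B - A) x) x \<in> \<real>\<^sub>\<ge>\<^sub>0)"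

definition isometries :: "('a::chilbert_space \<Rightarrow>\<^sub>L 'b::chilbert_space) set"
  where "isometries = {V \<in> clinear_ops. \<forall>x. norm (V x) = norm x}"


section \<open>Hilbert space tensor products\<close>

text \<open>
  \<open>hilbert_tensor t\<close> says that the Hilbert space \<open>'t\<close>, together with the simple tensors
  \<open>t x y\<close>, is the (completed) tensor product of \<open>'a\<close> and \<open>'b\<close>. This determines \<open>'t\<close> up to a
  unitary that respects simple tensors.
\<close>

locale hilbert_tensor =
  fixes t :: "'a::chilbert_space \<Rightarrow> 'b::chilbert_space \<Rightarrow> 't::chilbert_space"
  assumes add_left: "t (x + x') y = t x y + t x' y"
    and add_right: "t x (y + y') = t x y + t x y'"
    and scaleC_left: "t (c *\<^sub>C x) y = c *\<^sub>C t x y"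
    and scaleC_right: "t x (c *\<^sub>C y) = c *\<^sub>C t x y"
    and cinner_tensor: "cinner (t x y) (t x' y') = cinner x x' * cinner y y'"
    and dense: "closure (cspan {t x y | x y. True}) = UNIV"

definition tensor_op :: "('a::chilbert_space \<Rightarrow> 'b::chilbert_space \<Rightarrow> 't::chilbert_space)
    \<Rightarrow> ('a \<Rightarrow>\<^sub>L 'a) \<Rightarrow> ('b \<Rightarrow>\<^sub>L 'b) \<Rightarrow> ('t \<Rightarrow>\<^sub>L 't)"
  where "tensor_op t A B = (THE T :: 't \<Rightarrow>\<^sub>L 't. \<forall>x y. T (t x y) = t (A x) (B y))"


section \<open>Tuples of operators\<close>

text \<open>
  The generators are indexed by a finite type \<open>'n\<close>, so that \<open>n = CARD('n) \<ge> 1\<close>. Elements of the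
  free semigroup are words \<open>\<alpha> :: 'n list\<close>, with \<open>[]\<close> as the identity.
\<close>

definition word_op :: "('n \<Rightarrow> ('a::chilbert_space \<Rightarrow>\<^sub>L 'a)) \<Rightarrow> 'n list \<Rightarrow> ('a \<Rightarrow>\<^sub>L 'a)"
  where "word_op X \<alpha> = foldr (\<lambda>i T. X i o\<^sub>L T) \<alpha> id_blinfun"

definition row_ball :: "('n::finite \<Rightarrow> ('a::chilbert_space \<Rightarrow>\<^sub>L 'a)) set"
  where "row_ball = {X. (\<forall>i. X i \<in> clinear_ops) \<and> norm (\<Sum>i\<in>UNIV. X i o\<^sub>L adj (X i)) < 1}"

text \<open>
  The inclusion of \<open>H\<close> in the dilation space \<open>G\<close> is an isometry \<open>J\<close>; after identifying \<open>H\<close> with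
  \<open>J H\<close>, the compression of \<open>S\<close> to \<open>H\<close> is \<open>adj J o\<^sub>L S o\<^sub>L J\<close>. HOL cannot quantify
  over the type \<open>'g\<close> of \<open>G\<close>, so it is a parameter: the full class \<open>C\<^sub>\<rho>\<close> is the union of
  these sets over all \<open>'g\<close>, and a claim about all its members is one made for every \<open>'g\<close>.
\<close>

definition C_class :: "'g::chilbert_space itself \<Rightarrow> real
    \<Rightarrow> ('n::finite \<Rightarrow> ('h::chilbert_space \<Rightarrow>\<^sub>L 'h)) set"
  where "C_class _ \<rho> = {T. (\<forall>i. T i \<in> clinear_ops) \<and>
    (\<exists>(J :: 'h \<Rightarrow>\<^sub>L 'g) (V :: 'n \<Rightarrow> ('g \<Rightarrow>\<^sub>L 'g)).
      J \<in> isometries \<and>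
      (\<forall>i. V i \<in> isometries) \<and>
      (\<forall>i j x y. i \<noteq> j \<longrightarrow> cinner (V i x) (V j y) = 0) \<and>
      (\<forall>\<alpha>. \<alpha> \<noteq> [] \<longrightarrow> word_op T \<alpha> = \<rho> *\<^sub>R (adj J o\<^sub>L word_op V \<alpha> o\<^sub>L J)))}"


section \<open>Free holomorphic and free pluriharmonic functions\<close>

definition free_holomorphic :: "('n::finite list \<Rightarrow> ('e::chilbert_space \<Rightarrow>\<^sub>L 'e)) \<Rightarrow> bool"
  where "free_holomorphic A \<longleftrightarrow> (\<forall>\<alpha>. A \<alpha> \<in> clinear_ops) \<and>
    limsup (\<lambda>k. ereal (norm (\<Sum>\<alpha> | length \<alpha> = k. adj (A \<alpha>) o\<^sub>L A \<alpha>) powr (1 / (2 * real k)))) \<le> 1"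

definition free_hol_eval ::
  "('a::chilbert_space \<Rightarrow> 'e::chilbert_space \<Rightarrow> 't::chilbert_space)
    \<Rightarrow> ('n::finite list \<Rightarrow> ('e \<Rightarrow>\<^sub>L 'e)) \<Rightarrow> ('n \<Rightarrow> ('a \<Rightarrow>\<^sub>L 'a)) \<Rightarrow> ('t \<Rightarrow>\<^sub>L 't)"
  where "free_hol_eval t A X = (\<Sum>k. \<Sum>\<alpha> | length \<alpha> = k. tensor_op t (word_op X \<alpha>) (A \<alpha>))"

definition Re_free_hol ::
  "('a::chilbert_space \<Rightarrow> 'e::chilbert_space \<Rightarrow> 't::chilbert_space)
    \<Rightarrow> ('n::finite list \<Rightarrow> ('e \<Rightarrow>\<^sub>L 'e)) \<Rightarrow> ('n \<Rightarrow> ('a \<Rightarrow>\<^sub>L 'a)) \<Rightarrow> ('t \<Rightarrow>\<^sub>L 't)"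
  where "Re_free_hol t F X = (1/2) *\<^sub>R (adj (free_hol_eval t F X) + free_hol_eval t F X)"

text \<open>The coefficients of the two-sided series of \<open>Re F\<close> in terms of those of \<open>F\<close>.\<close>

definition Re_coeff ::
  "('n list \<Rightarrow> ('e::chilbert_space \<Rightarrow>\<^sub>L 'e)) \<Rightarrow> 'n list \<Rightarrow> ('e \<Rightarrow>\<^sub>L 'e)"
  where "Re_coeff F \<alpha> = (if \<alpha> = [] then (1/2) *\<^sub>R (adj (F []) + F []) else (1/2) *\<^sub>R F \<alpha>)"

definition free_pluriharm_eval ::
  "('a::chilbert_space \<Rightarrow> 'e::chilbert_space \<Rightarrow> 't::chilbert_space)
    \<Rightarrow> ('n::finite list \<Rightarrow> ('e \<Rightarrow>\<^sub>L 'e)) \<Rightarrow> ('n \<Rightarrow> ('a \<Rightarrow>\<^sub>L 'a)) \<Rightarrow> ('t \<Rightarrow>\<^sub>L 't)"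
  where "free_pluriharm_eval t A X =
    (\<Sum>k. \<Sum>\<alpha> | length \<alpha> = Suc k. tensor_op t (adj (word_op X \<alpha>)) (adj (A \<alpha>)))
    + tensor_op t id_blinfun (A [])
    + (\<Sum>k. \<Sum>\<alpha> | length \<alpha> = Suc k. tensor_op t (word_op X \<alpha>) (A \<alpha>))"

text \<open>
  \<open>A\<close> is the coefficient family of a positive free pluriharmonic function \<open>u = Re F\<close>; positivity is
  tested on the unit ball over the space \<open>'k\<close>, with \<open>t\<close> realising its tensor product with \<open>'e\<close>.
\<close>

definition positive_free_pluriharmonic ::
  "('k::chilbert_space \<Rightarrow> 'e::chilbert_space \<Rightarrow> 't::chilbert_space)
    \<Rightarrow> ('n::finite list \<Rightarrow> ('e \<Rightarrow>\<^sub>L 'e)) \<Rightarrow> bool"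
  where "positive_free_pluriharmonic t A \<longleftrightarrow>
    (\<exists>F. free_holomorphic F \<and> A = Re_coeff F \<and>
      (\<forall>X \<in> (row_ball :: ('n \<Rightarrow> ('k \<Rightarrow>\<^sub>L 'k)) set). op_le 0 (Re_free_hol t F X)))"

end

theory Submission
  imports Defs
begin

text \<open>
  If \<open>V\<close> is the row isometry dilating \<open>X\<close>, then \<open>u(rX) = \<rho> P u(rV)|\<^sub>H + (1 - \<rho>) u(0)\<close>, so the claim
  follows from \<open>(1 - r)/(1 + r) u(0) \<le> u(rV) \<le> (1 + r)/(1 - r) u(0)\<close>. Evaluating \<open>u\<close> at multiples
  of finite-rank truncations of the left creation operators shows that the multi-Toeplitz matrix
  of \<open>u\<close> is positive semidefinite. On finite sequences indexed by words it defines a semi-inner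
  product for which the right creation operators \<open>R\<^sub>i\<close> are isometries with orthogonal ranges.
  Hence \<open>Z = \<Sum>V\<^sub>i\<^sup>* \<otimes> R\<^sub>i\<close> is a contraction, and
  \<open>\<langle>u(rV) \<xi>, \<xi>\<rangle> = \<parallel>\<xi>\<parallel>\<^sup>2 + 2 Re \<Sum>\<^bsub>k\<ge>1\<^esub> r\<^sup>k \<langle>Z\<^sup>k \<xi>, \<xi>\<rangle>\<close>. With \<open>\<eta> = \<Sum>\<^bsub>k\<ge>0\<^esub> r\<^sup>k Z\<^sup>k \<xi>\<close> this number equals
  \<open>\<parallel>\<eta>\<parallel>\<^sup>2 - r\<^sup>2 \<parallel>Z \<eta>\<parallel>\<^sup>2\<close> while \<open>\<xi> = \<eta> - r Z \<eta>\<close>, and the two bounds follow from \<open>\<parallel>Z \<eta>\<parallel> \<le> \<parallel>\<eta>\<parallel>\<close>.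
  The same contraction bounds all homogeneous parts of the series uniformly, which gives
  convergence.
\<close>

section \<open>Complex Hilbert spaces\<close>

interpretation cvs: vector_space "scaleC :: complex \<Rightarrow> 'a::chilbert_space \<Rightarrow> 'a"
  by (rule vector_space_scaleC)

lemma cinner_add_right: "cinner x (y + z) = cinner x y + cinner x z"
  by (metis cinner_add_left cinner_commute complex_cnj_add)

lemma cinner_scaleC_right: "cinner x (c *\<^sub>C y) = cnj c * cinner x y"
  by (metis cinner_commute cinner_scaleC_left complex_cnj_mult)

lemma cinner_self: "cinner x x = of_real ((norm x)\<^sup>2)"
proof -
  have "Im (cinner x x) = 0"
    using cinner_commute [of x x] by (metis cnj.simps(2) equal_neg_zero)
  moreover have "Re (cinner x x) = (norm x)\<^sup>2"
    by (metis inner_eq_Re_cinner power2_norm_eq_inner)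
  ultimately show ?thesis by (simp add: complex_eq_iff)
qed

lemma norm_scaleC: "norm (c *\<^sub>C x) = cmod c * norm (x :: 'a::chilbert_space)"
proof -
  have "complex_of_real ((norm (c *\<^sub>C x))\<^sup>2) = c * cnj c * of_real ((norm x)\<^sup>2)"
    by (simp only: cinner_self [symmetric] cinner_scaleC_left cinner_scaleC_right) (simp only: mult_ac)
  also have "\<dots> = of_real ((cmod c * norm x)\<^sup>2)"
    by (simp add: complex_norm_square [symmetric] power_mult_distrib)
  finally have "(norm (c *\<^sub>C x))\<^sup>2 = (cmod c * norm x)\<^sup>2"
    by (simp only: of_real_eq_iff)
  then show ?thesis by (simp add: power2_eq_iff_nonneg)
qed

lemma cnj_sgn_mult: "cnj (sgn z) * z = complex_of_real (cmod z)"
proof (cases "z = 0")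
  case False
  then show ?thesis
    using complex_norm_square [of z]
    by (simp add: sgn_div_norm scaleR_conv_of_real divide_simps power2_eq_square mult.commute)
qed simp

text \<open>Multiplying \<open>x\<close> by a unimodular scalar makes the complex inner product real
  and nonnegative, which reduces the claim to the real Cauchy-Schwarz inequality.\<close>

lemma cmod_cinner_le: "cmod (cinner x y) \<le> norm x * norm y"
proof (cases "cinner x y = 0")
  case False
  define c where "c = cnj (sgn (cinner x y))"
  have c: "cmod c = 1" using False by (simp add: c_def norm_sgn)
  have "cinner (c *\<^sub>C x) y = of_real (cmod (cinner x y))"
    by (simp add: cinner_scaleC_left c_def cnj_sgn_mult)
  then have "cmod (cinner x y) = inner (c *\<^sub>C x) y"
    by (simp add: inner_eq_Re_cinner)
  also have "\<dots> \<le> norm (c *\<^sub>C x) * norm y" by (rule norm_cauchy_schwarz)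
  finally show ?thesis by (simp add: norm_scaleC c)
qed simp

interpretation cinner: bounded_bilinear "cinner :: 'a::chilbert_space \<Rightarrow> 'a \<Rightarrow> complex"
proof
  show "\<exists>K. \<forall>a b :: 'a. norm (cinner a b) \<le> norm a * norm b * K"
    by (rule exI [of _ 1]) (simp add: cmod_cinner_le)
qed (simp_all add: cinner_add_left cinner_add_right scaleC_of_real [symmetric]
  cinner_scaleC_left cinner_scaleC_right scaleR_conv_of_real)

interpretation scaleC: bounded_bilinear "scaleC :: complex \<Rightarrow> 'a::chilbert_space \<Rightarrow> 'a"
proof
  show "\<exists>K. \<forall>a (b :: 'a). norm (a *\<^sub>C b) \<le> norm a * norm b * K"
    by (rule exI [of _ 1]) (simp add: norm_scaleC)
qed (simp_all add: scaleC_add_left scaleC_add_right scaleC_of_real [symmetric]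
  scaleC_scaleC scaleR_conv_of_real mult.commute)

text \<open>The way to lift a real identity to a complex one: prove it for \<open>inner\<close>,
  then use it at \<open>y\<close> and at \<open>\<i> *\<^sub>C y\<close>.\<close>

lemma cinner_conv_inner: "cinner x y = Complex (inner x y) (inner x (\<i> *\<^sub>C y))"
  by (simp add: complex_eq_iff inner_eq_Re_cinner cinner_scaleC_right)

lemma cinner_eqI: "(\<And>z. cinner z x = cinner z y) \<Longrightarrow> x = y"
  using cinner_self [of "x - y"] by (simp add: cinner.diff_right)

text \<open>The representing vector is the maximiser of the concave functional \<open>2 f x - \<parallel>x\<parallel>\<^sup>2\<close>.\<close>

lemma riesz_representation:
  fixes f :: "'a::{real_inner,complete_space} \<Rightarrow> real"
  assumes "bounded_linear f"
  shows "\<exists>z. \<forall>x. f x = inner x z"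
proof -
  interpret f: bounded_linear f by fact
  define q where "q x = 2 * f x - (norm x)\<^sup>2" for x
  \<comment> \<open>The parallelogram law for the quadratic part. The midpoint value is at most
    \<open>S\<close>, so two near-maximisers must be close to each other; this makes the maximising
    sequence Cauchy.\<close>
  have q_mid: "4 * q ((1/2) *\<^sub>R (x + y)) = 2 * q x + 2 * q y + (norm (x - y))\<^sup>2" for x y
    by (simp add: q_def f.add f.scaleR power2_norm_eq_inner inner_add inner_diff
        inner_commute field_simps)
  have "q x \<le> (onorm f)\<^sup>2" for x
  proof -
    have "f x \<le> onorm f * norm x" using onorm [OF assms, of x] by simp
    then show ?thesis unfolding q_def
      using zero_le_power2 [of "onorm f - norm x"] by (simp add: power2_diff)
  qed
  then have bdd: "bdd_above (range q)" by (intro bdd_aboveI2)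
  define S where "S = (SUP x. q x)"
  have S: "q x \<le> S" for x unfolding S_def using bdd by (auto intro: cSUP_upper)
  define i where "i n = inverse (real (Suc n))" for n
  have i_pos: "0 < i n" for n by (simp add: i_def)
  have i_mono: "i n \<le> i N" if "N \<le> n" for N n
    using that by (simp add: i_def le_imp_inverse_le)
  have "\<exists>x. S - i n < q x" for n
    using less_cSUP_iff [of UNIV q "S - i n"] bdd i_pos [of n] unfolding S_def by simp
  then obtain X where X: "\<And>n. S - i n < q (X n)" by metis
  have dist: "(norm (X m - X n))\<^sup>2 \<le> 2 * i m + 2 * i n" for m n
  proof -
    have "2 * q (X m) + 2 * q (X n) + (norm (X m - X n))\<^sup>2 \<le> 4 * S"
      using S [of "(1/2) *\<^sub>R (X m + X n)"] unfolding q_mid [symmetric] by simp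
    with X [of m] X [of n] show ?thesis by linarith
  qed
  have "Cauchy X"
  proof (rule metric_CauchyI)
    fix e :: real assume "0 < e"
    then obtain N where "inverse (real (Suc N)) < e\<^sup>2 / 4"
      using reals_Archimedean [of "e\<^sup>2 / 4"] by auto
    then have N: "4 * i N < e\<^sup>2" by (simp add: i_def)
    have "dist (X m) (X n) < e" if "N \<le> m" "N \<le> n" for m n
    proof -
      have "(norm (X m - X n))\<^sup>2 < e\<^sup>2"
        using dist [of m n] N i_mono [OF that(1)] i_mono [OF that(2)] by linarith
      then show ?thesis using \<open>0 < e\<close> by (simp add: dist_norm power2_less_imp_less)
    qed
    then show "\<exists>M. \<forall>m\<ge>M. \<forall>n\<ge>M. dist (X m) (X n) < e" by blast
  qed
  then obtain z where z: "X \<longlonglongrightarrow> z" using Cauchy_convergent_iff convergent_def by blast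
  have "(\<lambda>n. q (X n)) \<longlonglongrightarrow> q z" unfolding q_def by (intro tendsto_intros f.tendsto z)
  moreover have "(\<lambda>n. S - i n) \<longlonglongrightarrow> S - 0"
    unfolding i_def by (intro tendsto_intros LIMSEQ_inverse_real_of_nat)
  ultimately have "S - 0 \<le> q z"
    by (rule tendsto_le [OF sequentially_bot]) (simp add: X less_imp_le)
  then have max: "q x \<le> q z" for x using S [of x] by simp
  have "f h = inner h z" for h
  proof (rule ccontr)
    assume "f h \<noteq> inner h z"
    define d where "d = f h - inner h z"
    define N where "N = inner h h"
    have d: "0 < d\<^sup>2" using \<open>f h \<noteq> inner h z\<close> by (simp add: d_def)
    have N: "0 \<le> N" by (simp add: N_def)
    \<comment> \<open>First variation: compare \<open>q\<close> at \<open>z\<close> and at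
      \<open>z + s *\<^sub>R h\<close>.\<close>
    have "2 * s * d \<le> s\<^sup>2 * N" for s
      using max [of "z + s *\<^sub>R h"] unfolding q_def power2_norm_eq_inner
      by (simp add: d_def N_def f.add f.scaleR inner_add_left inner_add_right
          inner_commute [of z h] algebra_simps power2_eq_square)
    \<comment> \<open>This \<open>s\<close> has the sign of \<open>d\<close> and makes the linear
      term dominate; the denominator \<open>1 + N\<close> stays positive even when
      \<open>h = 0\<close>.\<close>
    from this [of "d / (1 + N)"] have "d\<^sup>2 * (2 / (1 + N)) \<le> d\<^sup>2 * (N / (1 + N)\<^sup>2)"
      by (simp add: power_divide power2_eq_square mult_ac)
    then have "2 / (1 + N) \<le> N / (1 + N)\<^sup>2" using d by (simp only: mult_le_cancel_left_pos)
    moreover have "2 / (1 + N) = 2 * (1 + N) / (1 + N)\<^sup>2" using N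
        mult_divide_mult_cancel_right [of "1 + N" 2 "1 + N"] by (simp only: power2_eq_square)
    ultimately show False using N by (simp add: divide_le_cancel)
  qed
  then show ?thesis by blast
qed

section \<open>Adjoints of bounded complex-linear operators\<close>

lemma clinear_opsD: "A \<in> clinear_ops \<Longrightarrow> A (c *\<^sub>C x) = c *\<^sub>C A x"
  by (simp add: clinear_ops_def)

text \<open>Riesz representation gives the adjoint for the real inner products. Since
  \<open>A\<close> commutes with multiplication by \<i>, the same \<open>B\<close> also matches the
  imaginary parts.\<close>

lemma adj_exists:
  fixes A :: "'a::chilbert_space \<Rightarrow>\<^sub>L 'b::chilbert_space"
  assumes A: "A \<in> clinear_ops"
  shows "\<exists>B :: 'b \<Rightarrow>\<^sub>L 'a. \<forall>x y. cinner (A x) y = cinner x (B y)"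
proof -
  have "\<exists>z. \<forall>x. inner (A x) y = inner x z" for y
    by (rule riesz_representation, rule bounded_linear_compose
        [OF bounded_linear_inner_left blinfun.bounded_linear_right])
  then obtain B where B: "\<And>x y. inner (A x) y = inner x (B y)" by metis
  have "inner (A x) (\<i> *\<^sub>C y) = inner x (\<i> *\<^sub>C B y)" for x y
  proof -
    have "inner (A x) (\<i> *\<^sub>C y) = - inner (A (\<i> *\<^sub>C x)) y"
      by (simp add: inner_eq_Re_cinner clinear_opsD [OF A] cinner_scaleC_left cinner_scaleC_right)
    also have "\<dots> = inner x (\<i> *\<^sub>C B y)"
      by (simp only: B) (simp add: inner_eq_Re_cinner cinner_scaleC_left cinner_scaleC_right)
    finally show ?thesis .
  qed
  then have cB: "cinner (A x) y = cinner x (B y)" for x y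
    by (simp add: cinner_conv_inner B)
  have "bounded_linear B"
  proof (rule bounded_linear_intro)
    show "B (x + y) = B x + B y" for x y
      by (rule cinner_eqI) (simp add: cB [symmetric] cinner_add_right)
    show "B (c *\<^sub>R x) = c *\<^sub>R B x" for c x
      by (rule cinner_eqI) (simp add: cB [symmetric] cinner.scaleR_right)
    show "norm (B y) \<le> norm y * norm A" for y
    proof -
      have "(norm (B y))\<^sup>2 = inner (A (B y)) y" by (simp add: B power2_norm_eq_inner)
      also have "\<dots> \<le> norm (A (B y)) * norm y" by (rule norm_cauchy_schwarz)
      also have "\<dots> \<le> norm A * norm (B y) * norm y"
        by (intro mult_right_mono norm_blinfun) simp
      finally have "norm (B y) * norm (B y) \<le> norm (B y) * (norm y * norm A)"
        by (simp add: power2_eq_square mult_ac)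
      then show ?thesis
        by (cases "norm (B y) = 0") (simp_all add: mult_le_cancel_left_pos)
    qed
  qed
  then show ?thesis using cB by (intro exI [of _ "Blinfun B"]) (simp add: bounded_linear_Blinfun_apply)
qed

lemma adj_unique:
  fixes A :: "'a::chilbert_space \<Rightarrow>\<^sub>L 'b::chilbert_space" and B :: "'b \<Rightarrow>\<^sub>L 'a"
  assumes "\<And>x y. cinner (A x) y = cinner x (B y)"
  shows "adj A = B"
  unfolding adj_def
proof (rule the_equality)
  show "B' = B" if "\<forall>x y. cinner (A x) y = cinner x (blinfun_apply B' y)" for B'
    using that assms by (intro blinfun_eqI cinner_eqI) metis
qed (simp add: assms)

lemma cinner_adj_right: "A \<in> clinear_ops \<Longrightarrow> cinner x (adj A y) = cinner (A x) y"
  using adj_exists adj_unique by metis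

lemma cinner_adj_left: "A \<in> clinear_ops \<Longrightarrow> cinner (adj A y) x = cinner y (A x)"
  by (metis cinner_adj_right cinner_commute)

lemma clinear_adj:
  assumes A: "A \<in> clinear_ops"
  shows "adj A \<in> clinear_ops"
proof -
  have "adj A (c *\<^sub>C x) = c *\<^sub>C adj A x" for c x
    by (rule cinner_eqI) (simp add: cinner_adj_right [OF A] cinner_scaleC_right)
  then show ?thesis by (simp add: clinear_ops_def)
qed

lemma adj_zero [simp]: "adj 0 = 0"
  by (rule adj_unique) (simp add: cinner.zero_left cinner.zero_right)

lemma adj_compose:
  "A \<in> clinear_ops \<Longrightarrow> B \<in> clinear_ops \<Longrightarrow> adj (A o\<^sub>L B) = adj B o\<^sub>L adj A"
  by (rule adj_unique) (simp add: cinner_adj_right)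

lemma clinear_id [simp]: "id_blinfun \<in> clinear_ops"
  and clinear_zero [simp]: "0 \<in> clinear_ops"
  and clinear_compose: "A \<in> clinear_ops \<Longrightarrow> B \<in> clinear_ops \<Longrightarrow> A o\<^sub>L B \<in> clinear_ops"
  and clinear_add: "C \<in> clinear_ops \<Longrightarrow> D \<in> clinear_ops \<Longrightarrow> C + D \<in> clinear_ops"
  and clinear_scaleR: "C \<in> clinear_ops \<Longrightarrow> s *\<^sub>R C \<in> clinear_ops"
  by (simp_all add: clinear_ops_def blinfun.add_left blinfun.scaleR_left scaleC_add_right
      scaleC_of_real [symmetric] scaleC_scaleC mult.commute)

lemma clinear_sum: "(\<And>i. i \<in> I \<Longrightarrow> A i \<in> clinear_ops) \<Longrightarrow> (\<Sum>i\<in>I. A i) \<in> clinear_ops"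
  by (induction I rule: infinite_finite_induct) (auto intro: clinear_add)

section \<open>Operators on tensor products\<close>

text \<open>One Gram-Schmidt step per index: \<open>h\<close> removes the component along
  \<open>g a\<close>, the induction hypothesis factors the Gram matrix of \<open>h\<close>, and one
  new column records the removed components.\<close>

lemma gram_factorization:
  fixes g :: "'i \<Rightarrow> 'a::chilbert_space"
  assumes "finite I"
  shows "\<exists>(m::nat) c. \<forall>i\<in>I. \<forall>j\<in>I. cinner (g i) (g j) = (\<Sum>l<m. c i l * cnj (c j l))"
  using assms
proof (induction I arbitrary: g rule: finite_induct)
  case (insert a I)
  define h where "h i = g i - (cinner (g i) (g a) / of_real ((norm (g a))\<^sup>2)) *\<^sub>C g a" for i
  obtain m c where c: "\<And>i j. i \<in> I \<Longrightarrow> j \<in> I \<Longrightarrow>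
      cinner (h i) (h j) = (\<Sum>l<(m::nat). c i l * cnj (c j l))"
    using insert.IH [of h] by blast
  \<comment> \<open>Column \<open>m\<close> holds the coefficients along the normalised
    \<open>g a\<close>. If \<open>g a = 0\<close>, division by zero yields the zero column, as
    required.\<close>
  define c' where "c' i l = (if l < m then if i = a then 0 else c i l
      else cinner (g i) (g a) / of_real (norm (g a)))" for i l
  have ga: "cinner (g i) (g a) = c' i m * cnj (c' a m)" for i
    by (cases "g a = 0") (simp_all add: c'_def cinner_self cinner.zero_right power2_eq_square)
  have hg: "cinner (h i) (h j) + c' i m * cnj (c' j m) = cinner (g i) (g j)" for i j
  proof (cases "g a = 0")
    case False
    define n where "n = complex_of_real (norm (g a))"
    have n: "n \<noteq> 0" "cnj n = n" "cinner (g a) (g a) = n * n"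
      using False by (simp_all add: n_def cinner_self power2_eq_square)
    have h: "h i = g i - (cinner (g i) (g a) / (n * n)) *\<^sub>C g a" for i
      by (simp add: h_def n_def power2_eq_square)
    have u: "cinner (g a) (g j) = cnj (cinner (g j) (g a))" by (rule cinner_commute)
    have "cinner (h i) (h j) = cinner (g i) (g j)
        - cinner (g i) (g a) / (n * n) * cnj (cinner (g j) (g a))"
      using n(1)
      by (simp add: h cinner.diff_left cinner.diff_right cinner_scaleC_left
          cinner_scaleC_right n(2,3) u)
    then show ?thesis by (simp add: c'_def n(2) flip: n_def)
  next
    case True
    then show ?thesis by (simp add: h_def c'_def scaleC.zero_right)
  qed
  have "cinner (g i) (g j) = (\<Sum>l<Suc m. c' i l * cnj (c' j l))"
    if "i \<in> insert a I" "j \<in> insert a I" for i j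
  proof (cases "i = a \<or> j = a")
    case True
    have "(\<Sum>l<m. c' i l * cnj (c' j l)) = 0"
      using True by (intro sum.neutral) (auto simp: c'_def)
    moreover have "cinner (g i) (g j) = c' i m * cnj (c' j m)"
      using True ga [of i] ga [of j] cinner_commute [of "g i" "g j"] by auto
    ultimately show ?thesis by simp
  next
    case False
    have "(\<Sum>l<m. c' i l * cnj (c' j l)) = cinner (h i) (h j)"
      using False that by (simp add: c c'_def)
    then show ?thesis using hg [of i j] by simp
  qed
  then show ?case by blast
qed auto

text \<open>The Schur product theorem: after factoring the Gram matrix, each column \<open>l\<close>
  contributes the quadratic form of \<open>M\<close> at the scalars \<open>c i l\<close>.\<close>

lemma schur_nonneg:
  fixes g :: "'i \<Rightarrow> 'a::chilbert_space"
  assumes I: "finite I"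
    and M: "\<And>d. 0 \<le> Re (\<Sum>i\<in>I. \<Sum>j\<in>I. d i * cnj (d j) * M i j)"
  shows "0 \<le> Re (\<Sum>i\<in>I. \<Sum>j\<in>I. cinner (g i) (g j) * M i j)"
proof -
  obtain m c where c: "\<And>i j. i \<in> I \<Longrightarrow> j \<in> I \<Longrightarrow>
      cinner (g i) (g j) = (\<Sum>l<(m::nat). c i l * cnj (c j l))"
    using gram_factorization [OF I, of g] by metis
  have "(\<Sum>i\<in>I. \<Sum>j\<in>I. cinner (g i) (g j) * M i j)
      = (\<Sum>i\<in>I. \<Sum>j\<in>I. \<Sum>l<m. c i l * cnj (c j l) * M i j)"
    by (simp add: c sum_distrib_right)
  also have "\<dots> = (\<Sum>i\<in>I. \<Sum>l<m. \<Sum>j\<in>I. c i l * cnj (c j l) * M i j)"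
    by (intro sum.cong refl sum.swap)
  also have "\<dots> = (\<Sum>l<m. \<Sum>i\<in>I. \<Sum>j\<in>I. c i l * cnj (c j l) * M i j)"
    by (rule sum.swap)
  finally show ?thesis using M by (simp add: sum_nonneg)
qed

text \<open>Gram-Schmidt again: in infinite dimension there is always a vector outside the span of
  the finitely many vectors chosen so far. Indexing by words later gives a finite piece of Fock
  space inside the test space.\<close>

lemma orthonormal_family_exists:
  assumes inf: "infinite_cdim TYPE('k::chilbert_space)" and "finite W"
  shows "\<exists>e :: 'w \<Rightarrow> 'k. \<forall>\<alpha>\<in>W. \<forall>\<beta>\<in>W. cinner (e \<alpha>) (e \<beta>) = (if \<alpha> = \<beta> then 1 else 0)"
  using \<open>finite W\<close>
proof (induction W rule: finite_induct)
  case (insert a W)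
  then obtain e :: "'w \<Rightarrow> 'k" where
    e: "\<And>\<alpha> \<beta>. \<alpha> \<in> W \<Longrightarrow> \<beta> \<in> W \<Longrightarrow> cinner (e \<alpha>) (e \<beta>) = (if \<alpha> = \<beta> then 1 else 0)"
    by blast
  have "cspan (e ` W) \<noteq> UNIV" using inf insert.hyps by (simp add: infinite_cdim_def)
  then obtain v where v: "v \<notin> cspan (e ` W)" by blast
  define p where "p = (\<Sum>\<alpha>\<in>W. cinner v (e \<alpha>) *\<^sub>C e \<alpha>)"
  have "p \<in> cspan (e ` W)" unfolding p_def
    by (intro cvs.span_sum cvs.span_scale cvs.span_base imageI)
  then have "v - p \<noteq> 0" using v by auto
  define f where "f = (1 / norm (v - p)) *\<^sub>R (v - p)"
  have ff: "cinner f f = 1" using \<open>v - p \<noteq> 0\<close> by (simp add: f_def cinner_self)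
  have "cinner p (e \<beta>) = cinner v (e \<beta>)" if "\<beta> \<in> W" for \<beta>
    using that insert.hyps
    by (simp add: p_def cinner.sum_left cinner_scaleC_left e if_distrib cong: if_cong)
  then have fe: "cinner f (e \<beta>) = 0" if "\<beta> \<in> W" for \<beta>
    using that by (simp add: f_def cinner.scaleR_left cinner.diff_left)
  then have ef: "cinner (e \<beta>) f = 0" if "\<beta> \<in> W" for \<beta>
    using that by (metis cinner_commute complex_cnj_zero)
  show ?case
    using insert.hyps e ff fe ef by (intro exI [of _ "e(a := f)"]) auto
qed simp

text \<open>Points are given through a parametrisation \<open>p\<close> that may be far from
  injective. The Lipschitz bound does two jobs: \<open>F i\<close> depends only on
  \<open>p i\<close>, and the resulting map extends to the closure.\<close>

lemma lipschitz_dense_extension: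
  fixes p :: "'i \<Rightarrow> 's::metric_space" and F :: "'i \<Rightarrow> 't::complete_space"
  assumes dense: "closure (range p) = UNIV"
    and lip: "\<And>i j. dist (F i) (F j) \<le> C * dist (p i) (p j)"
  shows "\<exists>T. continuous_on UNIV T \<and> (\<forall>i. T (p i) = F i)"
proof -
  define T where "T v = F (SOME i. p i = v)" for v
  have T: "T (p i) = F i" for i
  proof -
    have "p (SOME j. p j = p i) = p i" by (rule someI) (rule refl)
    then show ?thesis using lip [of "SOME j. p j = p i" i] by (simp add: T_def)
  qed
  have "uniformly_continuous_on (range p) T"
    unfolding uniformly_continuous_on_def
  proof (intro allI impI)
    fix e :: real assume e: "0 < e"
    \<comment> \<open>\<open>\<bar>C\<bar> + 1\<close> replaces \<open>C\<close> in order to divide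
      by a positive number.\<close>
    have "dist (F i) (F j) < e" if "dist (p i) (p j) < e / (\<bar>C\<bar> + 1)" for i j
    proof -
      have "dist (F i) (F j) \<le> (\<bar>C\<bar> + 1) * dist (p i) (p j)"
        by (rule order_trans [OF lip mult_right_mono]) auto
      also have "\<dots> < e" using that by (simp add: pos_less_divide_eq mult.commute)
      finally show ?thesis .
    qed
    then show "\<exists>d>0. \<forall>x\<in>range p. \<forall>x'\<in>range p. dist x' x < d \<longrightarrow> dist (T x') (T x) < e"
      using e by (intro exI [of _ "e / (\<bar>C\<bar> + 1)"]) (auto simp: T)
  qed
  then obtain g where "uniformly_continuous_on UNIV g" "\<And>x. x \<in> range p \<Longrightarrow> T x = g x"
    using uniformly_continuous_on_extension_on_closure [of "range p" T] dense by metis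
  then show ?thesis using T uniformly_continuous_imp_continuous by (metis rangeI)
qed

lemma double_sum_cinner:
  fixes x :: "'i \<Rightarrow> 'a::chilbert_space" and y :: "'j \<Rightarrow> 'a"
  shows "cinner (\<Sum>i\<in>I. x i) (\<Sum>j\<in>J. y j) = (\<Sum>i\<in>I. \<Sum>j\<in>J. cinner (x i) (y j))"
  by (simp only: cinner.sum_left) (simp only: cinner.sum_right)

text \<open>For \<open>v\<close> the sum of the \<open>d i *\<^sub>C x i\<close>, the double sum is
  the square of \<open>norm A * norm v\<close> minus the square of \<open>norm (A v)\<close>. It
  supplies the kernel to which \<open>schur_nonneg\<close> is applied.\<close>

lemma gram_contraction:
  fixes A :: "'a::chilbert_space \<Rightarrow>\<^sub>L 'a"
  assumes A: "A \<in> clinear_ops"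
  shows "0 \<le> Re (\<Sum>i\<in>I. \<Sum>j\<in>I. d i * cnj (d j) *
    (of_real ((norm A)\<^sup>2) * cinner (x i) (x j) - cinner (A (x i)) (A (x j))))"
proof -
  let ?v = "\<Sum>i\<in>I. d i *\<^sub>C x i"
  have "(\<Sum>i\<in>I. \<Sum>j\<in>I. d i * cnj (d j) *
      (of_real ((norm A)\<^sup>2) * cinner (x i) (x j) - cinner (A (x i)) (A (x j))))
    = of_real ((norm A)\<^sup>2) * cinner ?v ?v - cinner (A ?v) (A ?v)"
    by (simp add: double_sum_cinner blinfun.sum_right clinear_opsD [OF A] cinner_scaleC_left
        cinner_scaleC_right sum_distrib_left sum_subtractf algebra_simps)
  also have "\<dots> = of_real ((norm A * norm ?v)\<^sup>2 - (norm (A ?v))\<^sup>2)"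
    by (simp add: cinner_self power_mult_distrib)
  finally show ?thesis using norm_blinfun [of A ?v] by (simp add: power_mono)
qed

section \<open>Tensor products of bounded operators on the completed tensor product\<close>

context hilbert_tensor
begin

sublocale tensor: bounded_bilinear t
proof
  show "t (r *\<^sub>R x) y = r *\<^sub>R t x y" "t x (r *\<^sub>R y) = r *\<^sub>R t x y" for r x y
    by (simp_all add: scaleC_of_real [symmetric] scaleC_left scaleC_right)
  have "norm (t x y) = norm x * norm y" for x y
  proof -
    have "complex_of_real ((norm (t x y))\<^sup>2) = of_real ((norm x * norm y)\<^sup>2)"
      by (simp only: cinner_self [symmetric] cinner_tensor) (simp add: cinner_self power_mult_distrib)
    then have "(norm (t x y))\<^sup>2 = (norm x * norm y)\<^sup>2" by (simp only: of_real_eq_iff)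
    then show ?thesis by (simp add: power2_eq_iff_nonneg)
  qed
  then show "\<exists>K. \<forall>x y. norm (t x y) \<le> norm x * norm y * K"
    by (intro exI [of _ 1]) simp
qed (simp_all add: add_left add_right)

lemma cinner_tensor_sum:
  "cinner (\<Sum>i\<in>I. t (x i) (y i)) (\<Sum>j\<in>J. t (x' j) (y' j))
    = (\<Sum>i\<in>I. \<Sum>j\<in>J. cinner (x i) (x' j) * cinner (y i) (y' j))"
  by (simp add: double_sum_cinner cinner_tensor)

text \<open>The difference of the squared sides is the entrywise product of the Gram matrix of
  \<open>y\<close> with the positive kernel of \<open>gram_contraction\<close>.\<close>

lemma norm_tensor_sum_left:
  assumes A: "A \<in> clinear_ops" and "finite I"
  shows "norm (\<Sum>i\<in>I. t (A (x i)) (y i)) \<le> norm A * norm (\<Sum>i\<in>I. t (x i) (y i))"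
proof (rule power2_le_imp_le)
  have "0 \<le> Re (\<Sum>i\<in>I. \<Sum>j\<in>I. cinner (y i) (y j) *
      (of_real ((norm A)\<^sup>2) * cinner (x i) (x j) - cinner (A (x i)) (A (x j))))"
    by (intro schur_nonneg gram_contraction assms)
  also have "(\<Sum>i\<in>I. \<Sum>j\<in>I. cinner (y i) (y j) *
      (of_real ((norm A)\<^sup>2) * cinner (x i) (x j) - cinner (A (x i)) (A (x j))))
    = of_real ((norm A)\<^sup>2) * cinner (\<Sum>i\<in>I. t (x i) (y i)) (\<Sum>i\<in>I. t (x i) (y i))
      - cinner (\<Sum>i\<in>I. t (A (x i)) (y i)) (\<Sum>i\<in>I. t (A (x i)) (y i))"
    by (simp add: cinner_tensor_sum sum_distrib_left sum_subtractf algebra_simps)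
  finally show "(norm (\<Sum>i\<in>I. t (A (x i)) (y i)))\<^sup>2 \<le> (norm A * norm (\<Sum>i\<in>I. t (x i) (y i)))\<^sup>2"
    by (simp add: cinner_self power_mult_distrib flip: of_real_power of_real_mult of_real_diff)
qed simp

lemma norm_tensor_sum_right:
  assumes B: "B \<in> clinear_ops" and "finite I"
  shows "norm (\<Sum>i\<in>I. t (x i) (B (y i))) \<le> norm B * norm (\<Sum>i\<in>I. t (x i) (y i))"
proof (rule power2_le_imp_le)
  have "0 \<le> Re (\<Sum>i\<in>I. \<Sum>j\<in>I. cinner (x i) (x j) *
      (of_real ((norm B)\<^sup>2) * cinner (y i) (y j) - cinner (B (y i)) (B (y j))))"
    by (intro schur_nonneg gram_contraction assms)
  also have "(\<Sum>i\<in>I. \<Sum>j\<in>I. cinner (x i) (x j) *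
      (of_real ((norm B)\<^sup>2) * cinner (y i) (y j) - cinner (B (y i)) (B (y j))))
    = of_real ((norm B)\<^sup>2) * cinner (\<Sum>i\<in>I. t (x i) (y i)) (\<Sum>i\<in>I. t (x i) (y i))
      - cinner (\<Sum>i\<in>I. t (x i) (B (y i))) (\<Sum>i\<in>I. t (x i) (B (y i)))"
    by (simp add: cinner_tensor_sum sum_distrib_left sum_subtractf algebra_simps)
  finally show "(norm (\<Sum>i\<in>I. t (x i) (B (y i))))\<^sup>2 \<le> (norm B * norm (\<Sum>i\<in>I. t (x i) (y i)))\<^sup>2"
    by (simp add: cinner_self power_mult_distrib flip: of_real_power of_real_mult of_real_diff)
qed simp

lemma norm_tensor_sum:
  assumes A: "A \<in> clinear_ops" and B: "B \<in> clinear_ops" and I: "finite I"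
  shows "norm (\<Sum>i\<in>I. t (A (x i)) (B (y i))) \<le> norm A * norm B * norm (\<Sum>i\<in>I. t (x i) (y i))"
proof -
  have "norm (\<Sum>i\<in>I. t (A (x i)) (B (y i))) \<le> norm A * norm (\<Sum>i\<in>I. t (x i) (B (y i)))"
    by (rule norm_tensor_sum_left [OF A I])
  also have "\<dots> \<le> norm A * (norm B * norm (\<Sum>i\<in>I. t (x i) (y i)))"
    by (intro mult_left_mono norm_tensor_sum_right [OF B I]) simp
  finally show ?thesis by (simp add: mult.assoc)
qed

text \<open>Lists of pairs serve as formal sums of simple tensors: concatenation is addition, and
  scaling the first components is scaling.\<close>

definition tlist :: "('a \<times> 'b) list \<Rightarrow> 't"
  where "tlist l = (\<Sum>p\<leftarrow>l. t (fst p) (snd p))"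

lemma tlist_simps [simp]:
  "tlist [] = 0" "tlist (p # l) = t (fst p) (snd p) + tlist l"
  "tlist (l @ l') = tlist l + tlist l'"
  by (simp_all add: tlist_def)

lemma tlist_map_scaleC: "tlist (map (\<lambda>p. (c *\<^sub>C fst p, snd p)) l) = c *\<^sub>C tlist l"
  by (induction l) (simp_all add: scaleC_left scaleC_add_right)

lemma tlist_conv_sum: "tlist l = (\<Sum>i<length l. t (fst (l ! i)) (snd (l ! i)))"
  by (simp add: tlist_def sum_list_sum_nth atLeast0LessThan)

lemma dense_tlist: "closure (range tlist) = UNIV"
proof -
  have "cspan {t x y | x y. True} \<subseteq> range tlist"
  proof (rule cvs.span_minimal)
    show "{t x y | x y. True} \<subseteq> range tlist"
    proof clarify
      show "t x y \<in> range tlist" for x y by (rule range_eqI [of _ _ "[(x, y)]"]) simp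
    qed
    show "cvs.subspace (range tlist)"
      unfolding cvs.subspace_def
      by (auto intro: range_eqI [of _ _ "[]"] simp: tlist_simps(3) [symmetric]
          tlist_map_scaleC [symmetric] simp del: tlist_simps(3))
  qed
  then show ?thesis using dense closure_mono by blast
qed

text \<open>The standard way below to prove a closed property of all tensors: check it on finite
  sums of simple tensors.\<close>

lemma dense_induct:
  assumes "closed {v. P v}" and "\<And>(n::nat) x y. P (\<Sum>i<n. t (x i) (y i))"
  shows "P v"
proof -
  have "range tlist \<subseteq> {v. P v}" using assms(2) by (auto simp: tlist_conv_sum)
  then have "closure (range tlist) \<subseteq> {v. P v}" by (rule closure_minimal) fact
  then show ?thesis by (auto simp: dense_tlist)
qed

text \<open>The operator is defined on formal sums. The bound \<open>norm_tensor_sum\<close>,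
  applied to differences, makes it Lipschitz in the represented vector, so it is well defined and
  extends; linearity and boundedness follow by density.\<close>

lemma tensor_op_exists:
  assumes A: "A \<in> clinear_ops" and B: "B \<in> clinear_ops"
  shows "\<exists>T :: 't \<Rightarrow>\<^sub>L 't. \<forall>x y. T (t x y) = t (A x) (B y)"
proof -
  define F where "F l = tlist (map (\<lambda>p. (A (fst p), B (snd p))) l)" for l
  have F_append: "F (l @ l') = F l + F l'" for l l' by (simp add: F_def)
  have F_scaleC: "F (map (\<lambda>p. (c *\<^sub>C fst p, snd p)) l) = c *\<^sub>C F l" for c l
    by (simp add: F_def tlist_map_scaleC [symmetric] clinear_opsD [OF A] o_def)
  have F_bound: "norm (F l) \<le> norm A * norm B * norm (tlist l)" for l
    unfolding F_def tlist_conv_sum using norm_tensor_sum [OF A B, of "{..<length l}"] by simp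
  have "dist (F l) (F l') \<le> norm A * norm B * dist (tlist l) (tlist l')" for l l'
  proof -
    have m: "(- 1) *\<^sub>C v = - v" for v :: 't using scaleC_of_real [of "-1" v] by simp
    \<comment> \<open>The difference of two formal sums is represented by appending the negated
      second list to the first.\<close>
    show ?thesis
      using F_bound [of "l @ map (\<lambda>p. ((- 1) *\<^sub>C fst p, snd p)) l'"]
      by (simp only: F_append F_scaleC tlist_simps tlist_map_scaleC m) (simp add: dist_norm)
  qed
  then obtain T where cont: "continuous_on UNIV T" and T: "\<And>l. T (tlist l) = F l"
    using lipschitz_dense_extension [OF dense_tlist] by metis
  have cont' [continuous_intros]: "continuous_on S (\<lambda>v. T (h v))"
    if "continuous_on S h" for S :: "'t set" and h
    using continuous_on_compose2 [OF cont that] by simp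
  have list: "P v" if "closed {v. P v}" "\<And>l. P (tlist l)" for P v
  proof -
    have "closure (range tlist) \<subseteq> {v. P v}" by (rule closure_minimal) (use that in auto)
    then show ?thesis by (auto simp: dense_tlist)
  qed
  have "bounded_linear T"
  proof (rule bounded_linear_intro)
    \<comment> \<open>Density is used twice, in one variable at a time.\<close>
    show "T (v + w) = T v + T w" for v w
    proof (rule list [of "\<lambda>v. T (v + w) = T v + T w"])
      show "T (tlist l + w) = T (tlist l) + T w" for l
        by (rule list [of "\<lambda>w. T (tlist l + w) = T (tlist l) + T w"])
          (auto intro!: closed_Collect_eq continuous_intros simp: T F_append
            simp flip: tlist_simps(3))
    qed (intro closed_Collect_eq continuous_intros)
    show "T (c *\<^sub>R v) = c *\<^sub>R T v" for c v
    proof (rule list [of "\<lambda>v. T (c *\<^sub>R v) = c *\<^sub>R T v"])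
      show "T (c *\<^sub>R tlist l) = c *\<^sub>R T (tlist l)" for l
        by (simp only: scaleC_of_real [symmetric] tlist_map_scaleC [symmetric] T F_scaleC)
    qed (intro closed_Collect_eq continuous_intros)
    show "norm (T v) \<le> norm v * (norm A * norm B)" for v
    proof (rule list [of "\<lambda>v. norm (T v) \<le> norm v * (norm A * norm B)"])
      show "norm (T (tlist l)) \<le> norm (tlist l) * (norm A * norm B)" for l
        using F_bound [of l] by (simp add: T mult.commute)
    qed (intro closed_Collect_le continuous_intros)
  qed
  moreover have "T (t x y) = t (A x) (B y)" for x y
    using T [of "[(x, y)]"] by (simp add: F_def)
  ultimately show ?thesis by (intro exI [of _ "Blinfun T"]) (simp add: bounded_linear_Blinfun_apply)
qed

lemma blinfun_tensor_eqI:
  fixes S T :: "'t \<Rightarrow>\<^sub>L 'z::real_normed_vector"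
  assumes "\<And>x y. S (t x y) = T (t x y)"
  shows "S = T"
proof (rule blinfun_eqI)
  show "S v = T v" for v
    by (rule dense_induct [of "\<lambda>v. S v = T v"])
      (auto simp: blinfun.sum_right assms intro!: closed_Collect_eq continuous_intros)
qed

lemma tensor_op_unique:
  fixes T :: "'t \<Rightarrow>\<^sub>L 't" and A :: "'a \<Rightarrow>\<^sub>L 'a" and B :: "'b \<Rightarrow>\<^sub>L 'b"
  assumes "\<And>x y. T (t x y) = t (A x) (B y)"
  shows "tensor_op t A B = T"
  unfolding tensor_op_def
  by (rule the_equality) (auto simp: assms intro!: blinfun_tensor_eqI)

lemma tensor_op_apply:
  "A \<in> clinear_ops \<Longrightarrow> B \<in> clinear_ops \<Longrightarrow> tensor_op t A B (t x y) = t (A x) (B y)"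
  using tensor_op_exists tensor_op_unique by metis

lemma tensor_op_zero_left [simp]: "tensor_op t 0 B = 0"
  by (rule tensor_op_unique) (simp add: tensor.zero_left)

lemma clinear_tensor_op:
  assumes "A \<in> clinear_ops" "B \<in> clinear_ops"
  shows "tensor_op t A B \<in> clinear_ops"
proof -
  have "tensor_op t A B (c *\<^sub>C v) = c *\<^sub>C tensor_op t A B v" for c v
    by (rule dense_induct [of "\<lambda>v. tensor_op t A B (c *\<^sub>C v) = c *\<^sub>C tensor_op t A B v"])
      (auto intro!: closed_Collect_eq continuous_intros scaleC.continuous_on
        simp: blinfun.sum_right scaleC.sum_right tensor_op_apply assms clinear_opsD
          simp flip: scaleC_left)
  then show ?thesis by (simp add: clinear_ops_def)
qed

lemma adj_tensor_op:
  assumes A: "A \<in> clinear_ops" and B: "B \<in> clinear_ops"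
  shows "adj (tensor_op t A B) = tensor_op t (adj A) (adj B)"
proof (rule sym, rule tensor_op_unique, rule cinner_eqI)
  fix x y v
  show "cinner v (adj (tensor_op t A B) (t x y)) = cinner v (t (adj A x) (adj B y))"
    by (rule dense_induct [of "\<lambda>v. cinner v (adj (tensor_op t A B) (t x y))
          = cinner v (t (adj A x) (adj B y))"])
      (auto intro!: closed_Collect_eq continuous_intros cinner.continuous_on
        simp: cinner.sum_left cinner_adj_right clinear_tensor_op tensor_op_apply cinner_tensor assms)
qed

lemma cinner_tensor_op_sum:
  assumes "A \<in> clinear_ops" "B \<in> clinear_ops"
  shows "cinner (tensor_op t A B (\<Sum>i\<in>I. t (x i) (y i))) (\<Sum>j\<in>J. t (x' j) (y' j))
    = (\<Sum>i\<in>I. \<Sum>j\<in>J. cinner (A (x i)) (x' j) * cinner (B (y i)) (y' j))"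
  by (simp add: blinfun.sum_right tensor_op_apply assms cinner_tensor_sum)

end

section \<open>Harnack's inequality for a contraction\<close>

text \<open>For a contraction \<open>Z\<close>, read \<open>p\<close> and \<open>q\<close> as the
  squared norms of \<eta> and Z \<eta>, and \<open>c\<close> as twice the real part of their inner
  product. Then \<open>p + r\<^sup>2 * q - r * c\<close> is the squared norm of \<eta> - r Z \<eta>.
  In both inequalities the difference of the sides is \<open>r\<close> times a sum of nonnegative
  products.\<close>

lemma harnack_quadratic:
  fixes p q c r :: real
  assumes "0 \<le> r" "r < 1" "q \<le> p" "c \<le> p + q" "- c \<le> p + q"
  shows "(1 - r) * (p - r\<^sup>2 * q) \<le> (1 + r) * (p + r\<^sup>2 * q - r * c)"
    and "(1 - r) * (p + r\<^sup>2 * q - r * c) \<le> (1 + r) * (p - r\<^sup>2 * q)"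
proof -
  have "0 \<le> (1 - r) * (p - q)" "0 \<le> (1 + r) * (p + q - c)"
    "0 \<le> (1 + r) * (p - q)" "0 \<le> (1 - r) * (p + q + c)"
    using assms by (simp_all add: mult_nonneg_nonneg)
  then have "0 \<le> r * ((1 - r) * (p - q) + (1 + r) * (p + q - c))"
    and *: "0 \<le> r * ((1 + r) * (p - q) + (1 - r) * (p + q + c))"
    using assms(1) by (simp_all add: mult_nonneg_nonneg)
  then show "(1 - r) * (p - r\<^sup>2 * q) \<le> (1 + r) * (p + r\<^sup>2 * q - r * c)"
    by (simp add: algebra_simps power2_eq_square)
  show "(1 - r) * (p + r\<^sup>2 * q - r * c) \<le> (1 + r) * (p - r\<^sup>2 * q)"
    using * by (simp add: algebra_simps power2_eq_square)
qed

lemma sum_two_points: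
  fixes f :: "nat \<Rightarrow> nat \<Rightarrow> 'c::comm_monoid_add"
  assumes "k < l" "\<And>i j. i \<noteq> k \<Longrightarrow> i \<noteq> l \<Longrightarrow> f i j = 0" "\<And>i j. j \<noteq> k \<Longrightarrow> j \<noteq> l \<Longrightarrow> f i j = 0"
  shows "(\<Sum>i\<le>l. \<Sum>j\<le>l. f i j) = f k k + f k l + (f l k + f l l)"
proof -
  have "(\<Sum>j\<le>l. f i j) = (\<Sum>j\<in>{k, l}. f i j)" for i
    using assms by (intro sum.mono_neutral_right) auto
  then have "(\<Sum>i\<le>l. \<Sum>j\<le>l. f i j) = (\<Sum>i\<le>l. \<Sum>j\<in>{k, l}. f i j)" by simp
  also have "\<dots> = (\<Sum>i\<in>{k, l}. \<Sum>j\<in>{k, l}. f i j)"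
    using assms by (intro sum.mono_neutral_right) auto
  also have "\<dots> = f k k + f k l + (f l k + f l l)" using \<open>k < l\<close> by simp
  finally show ?thesis .
qed

lemma sum_one_point:
  fixes f :: "nat \<Rightarrow> nat \<Rightarrow> 'c::comm_monoid_add"
  assumes "\<And>i j. i \<noteq> k \<Longrightarrow> f i j = 0" "\<And>i j. j \<noteq> k \<Longrightarrow> f i j = 0"
  shows "(\<Sum>i\<le>k. \<Sum>j\<le>k. f i j) = f k k"
proof -
  have "(\<Sum>j\<le>k. f i j) = (\<Sum>j\<in>{k}. f i j)" for i
    using assms by (intro sum.mono_neutral_right) auto
  then have "(\<Sum>i\<le>k. \<Sum>j\<le>k. f i j) = (\<Sum>i\<le>k. f i k)" by simp
  also have "\<dots> = (\<Sum>i\<in>{k}. f i k)"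
    using assms by (intro sum.mono_neutral_right) auto
  finally show ?thesis by simp
qed

text \<open>
  In the application, \<open>b k l + cnj (b l k)\<close> is, up to a factor, the inner product of \<open>Z\<^sup>k \<xi>\<close> and
  \<open>Z\<^sup>l \<xi>\<close> for a contraction \<open>Z\<close>; assumption \<open>decr\<close> expresses contractivity.
\<close>

locale contraction_moments =
  fixes b :: "nat \<Rightarrow> nat \<Rightarrow> complex"
  assumes upper: "l < k \<Longrightarrow> b k l = 0"
    and pos: "0 \<le> Re (\<Sum>k\<le>N. \<Sum>l\<le>N. c k * cnj (c l) * b k l)"
    and decr: "0 \<le> Re (\<Sum>k\<le>N. \<Sum>l\<le>N. c k * cnj (c l) * (b k l - b (Suc k) (Suc l)))"
begin

lemma diag_nonneg: "0 \<le> Re (b k k)"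
proof -
  define c :: "nat \<Rightarrow> complex" where "c i = (if i = k then 1 else 0)" for i
  have "(\<Sum>i\<le>k. \<Sum>j\<le>k. c i * cnj (c j) * b i j) = c k * cnj (c k) * b k k"
    by (rule sum_one_point) (simp_all add: c_def)
  then show ?thesis using pos [where N = k and c = c] by (simp add: c_def)
qed

lemma diag_le: "Re (b k k) \<le> Re (b 0 0)"
proof (induction k)
  case (Suc k)
  define c :: "nat \<Rightarrow> complex" where "c i = (if i = k then 1 else 0)" for i
  have "(\<Sum>i\<le>k. \<Sum>j\<le>k. c i * cnj (c j) * (b i j - b (Suc i) (Suc j)))
      = c k * cnj (c k) * (b k k - b (Suc k) (Suc k))"
    by (rule sum_one_point) (simp_all add: c_def)
  then show ?case using Suc decr [where N = k and c = c] by (simp add: c_def)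
qed simp

text \<open>A Cauchy-Schwarz estimate: test positivity on the indices \<open>k\<close> and
  \<open>l\<close> only. The entry \<open>b l k\<close> vanishes by \<open>upper\<close>, and each
  diagonal entry is at most \<open>Re (b 0 0)\<close>, whence the factor 2.\<close>

lemma off_diag_le:
  assumes "k < l"
  shows "cmod (b k l) \<le> 2 * Re (b 0 0)"
proof -
  \<comment> \<open>The phase turns the mixed term into \<open>- cmod (b k l)\<close>. It is 0 when
    \<open>b k l = 0\<close>, so only \<open>cmod s \<le> 1\<close> is available.\<close>
  define s where "s = - cnj (sgn (b k l))"
  have "cmod s \<le> 1" by (simp add: s_def norm_sgn)
  have sb: "s * b k l = - of_real (cmod (b k l))"
    by (simp add: s_def cnj_sgn_mult)
  define c where "c i = (if i = k then s else if i = l then 1 else 0)" for i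
  have c: "c k = s" "c l = 1" "i \<noteq> k \<Longrightarrow> i \<noteq> l \<Longrightarrow> c i = 0" for i
    using \<open>k < l\<close> by (auto simp: c_def)
  have "(\<Sum>i\<le>l. \<Sum>j\<le>l. c i * cnj (c j) * b i j)
    = c k * cnj (c k) * b k k + c k * cnj (c l) * b k l
      + (c l * cnj (c k) * b l k + c l * cnj (c l) * b l l)"
    using \<open>k < l\<close> by (rule sum_two_points) (simp_all add: c)
  then have "0 \<le> Re (s * cnj s * b k k + s * b k l + (cnj s * b l k + b l l))"
    using pos [where N = l and c = c] by (simp add: c)
  also have "\<dots> = (cmod s)\<^sup>2 * Re (b k k) - cmod (b k l) + Re (b l l)"
    using upper [OF \<open>k < l\<close>] by (simp add: sb flip: complex_norm_square of_real_power)
  also have "\<dots> \<le> Re (b k k) - cmod (b k l) + Re (b l l)"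
    using mult_right_mono [OF power_le_one [OF norm_ge_zero \<open>cmod s \<le> 1\<close>] diag_nonneg] by simp
  finally show ?thesis using diag_le [of k] diag_le [of l] by linarith
qed

lemma abs_Re_le: "\<bar>Re (b k l)\<bar> \<le> 2 * Re (b 0 0)"
proof (cases k l rule: linorder_cases)
  case less
  then show ?thesis using off_diag_le abs_Re_le_cmod order_trans by blast
next
  case equal
  then show ?thesis using diag_nonneg [of l] diag_le [of l] by simp
next
  case greater
  then show ?thesis using diag_nonneg [of 0] by (simp add: upper)
qed

lemma summable_row:
  assumes "0 \<le> r" "r < 1"
  shows "summable (\<lambda>l. r ^ l * Re (b 0 l))"
proof (rule summable_comparison_test')
  show "summable (\<lambda>l. r ^ l * (2 * Re (b 0 0)))"
    using assms by (intro summable_mult2 summable_geometric) simp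
  show "norm (r ^ l * Re (b 0 l)) \<le> r ^ l * (2 * Re (b 0 0))" for l
    using assms abs_Re_le [of 0 l] by (simp add: abs_mult mult_left_mono)
qed

text \<open>The Harnack argument for the truncated vector \<eta>, the sum of r^k Z^k \<xi> over k
  \<le> N. Here \<open>Q\<close> is the form at \<eta> - r Z \<eta> and \<open>P\<close> is the form
  at \<eta> minus r^2 times the form at Z \<eta>; the terms with a factor \<open>r ^ M\<close> are
  the truncation errors.\<close>

lemma harnack_partial:
  fixes r :: real and N :: nat
  defines "M \<equiv> Suc N"
  assumes r: "0 \<le> r" "r < 1"
  defines "P \<equiv> (\<Sum>l\<le>M. r ^ l * Re (b 0 l)) - r ^ M * (\<Sum>k\<le>M. r ^ k * Re (b k M))"
    and "Q \<equiv> Re (b 0 0) - r ^ M * Re (b 0 M) + r ^ M * r ^ M * Re (b M M)"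
  shows "(1 - r) * P \<le> (1 + r) * Q" and "(1 - r) * Q \<le> (1 + r) * P"
proof -
  define B where "B u v = (\<Sum>k\<le>M. \<Sum>l\<le>M. u k * v l * Re (b k l))" for u v :: "nat \<Rightarrow> real"
  have B_nonneg: "0 \<le> B u u" for u
    using pos [where N = M and c = "\<lambda>k. of_real (u k)"] by (simp add: B_def)
  have B_add: "B (\<lambda>k. u k + s * v k) w = B u w + s * B v w"
    "B w (\<lambda>k. u k + s * v k) = B w u + s * B w v" for u v w s
    by (simp_all add: B_def sum.distrib sum_distrib_left algebra_simps)
  \<comment> \<open>\<open>x\<close>, \<open>z\<close> and \<open>d\<close> are the coefficients of
    \<eta>, Z \<eta> and \<eta> - r Z \<eta> in the vectors Z^k \<xi>. The last one telescopes to
    \<xi> - r^M Z^M \<xi>.\<close>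
  define x where "x k = (if k \<le> N then r ^ k else 0)" for k
  define z where "z k = (if k = 0 then 0 else r ^ (k - 1))" for k :: nat
  define d where "d k = x k + (- r) * z k" for k
  have d: "d k = (if k = 0 then 1 else if k = M then - (r ^ M) else 0)" if "k \<le> M" for k
    using that by (cases k) (auto simp: d_def x_def z_def M_def)
  have *: "(\<Sum>k\<le>M. d k * g k) = g 0 - r ^ M * g M" for g :: "nat \<Rightarrow> real"
  proof -
    have M0: "0 \<noteq> M" by (simp add: M_def)
    have "(\<Sum>k\<le>M. d k * g k) = (\<Sum>k\<in>{0, M}. d k * g k)"
      by (intro sum.mono_neutral_right) (auto simp: d)
    also have "\<dots> = d 0 * g 0 + d M * g M" using M0 by simp
    also have "\<dots> = g 0 - r ^ M * g M" using M0 by (simp only: d) simp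
    finally show ?thesis .
  qed
  have Bd: "B d v = (\<Sum>l\<le>M. v l * Re (b 0 l)) - r ^ M * (\<Sum>l\<le>M. v l * Re (b M l))"
    "B v d = (\<Sum>k\<le>M. v k * Re (b k 0)) - r ^ M * (\<Sum>k\<le>M. v k * Re (b k M))" for v
  proof -
    have "B d v = (\<Sum>k\<le>M. d k * (\<Sum>l\<le>M. v l * Re (b k l)))"
      by (simp add: B_def sum_distrib_left mult.assoc)
    then show "B d v = (\<Sum>l\<le>M. v l * Re (b 0 l)) - r ^ M * (\<Sum>l\<le>M. v l * Re (b M l))"
      by (simp only: *)
    have "B v d = (\<Sum>k\<le>M. v k * (\<Sum>l\<le>M. d l * Re (b k l)))"
      by (simp add: B_def sum_distrib_left mult.assoc)
    then show "B v d = (\<Sum>k\<le>M. v k * Re (b k 0)) - r ^ M * (\<Sum>k\<le>M. v k * Re (b k M))"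
      by (simp only: *) (simp add: algebra_simps sum_subtractf sum_distrib_left)
  qed
  have Bxx: "B x x = (\<Sum>k\<le>N. \<Sum>l\<le>N. r ^ k * r ^ l * Re (b k l))"
    by (simp add: B_def M_def x_def)
  have Bzz: "B z z = (\<Sum>k\<le>N. \<Sum>l\<le>N. r ^ k * r ^ l * Re (b (Suc k) (Suc l)))"
    by (simp only: B_def M_def sum.atMost_Suc_shift) (simp add: z_def)
  \<comment> \<open>Contractivity at \<eta>; the next two facts are positivity at \<eta> - Z \<eta>
    and \<eta> + Z \<eta>. Together they are the hypotheses of \<open>harnack_quadratic\<close> with
    \<open>c = B x z + B z x\<close>.\<close>
  have "B z z \<le> B x x"
    using decr [where N = N and c = "\<lambda>k. of_real (r ^ k)"]
    by (simp add: Bxx Bzz sum_subtractf right_diff_distrib flip: of_real_power of_real_mult)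
  moreover have "B x z + B z x \<le> B x x + B z z"
    using B_nonneg [of "\<lambda>k. x k + (- 1) * z k"] by (simp only: B_add) simp
  moreover have "- (B x z + B z x) \<le> B x x + B z z"
    using B_nonneg [of "\<lambda>k. x k + 1 * z k"] by (simp only: B_add) simp
  ultimately have quad:
    "(1 - r) * (B x x - r\<^sup>2 * B z z) \<le> (1 + r) * (B x x + r\<^sup>2 * B z z - r * (B x z + B z x))"
    "(1 - r) * (B x x + r\<^sup>2 * B z z - r * (B x z + B z x)) \<le> (1 + r) * (B x x - r\<^sup>2 * B z z)"
    using harnack_quadratic [OF r] by blast+
  have "B x x + r\<^sup>2 * B z z - r * (B x z + B z x) = B d d"
    unfolding d_def by (simp only: B_add) (simp add: algebra_simps power2_eq_square)
  also have "\<dots> = Q"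
    using upper [of 0 M] by (simp only: Bd *) (simp add: Q_def M_def algebra_simps)
  finally have Q: "B x x + r\<^sup>2 * B z z - r * (B x z + B z x) = Q" .
  \<comment> \<open>\<open>B\<close> is not symmetric, so the arguments are ordered to make the two
    occurrences of \<open>r * B x z\<close> cancel. Since \<open>d\<close> has only two nonzero
    entries, both terms reduce to single sums.\<close>
  have "B x x - r\<^sup>2 * B z z = B x d + r * B d z"
    unfolding d_def by (simp only: B_add) (simp add: algebra_simps power2_eq_square)
  also have "\<dots> = P"
  proof -
    have 1: "(\<Sum>k\<le>M. x k * Re (b k 0)) = Re (b 0 0)"
    proof -
      have "(\<Sum>k\<le>M. x k * Re (b k 0)) = (\<Sum>k\<in>{0}. x k * Re (b k 0))"
        by (intro sum.mono_neutral_right) (auto simp: upper)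
      then show ?thesis by (simp add: x_def)
    qed
    have 2: "(\<Sum>k\<le>M. x k * Re (b k M)) = (\<Sum>k\<le>N. r ^ k * Re (b k M))"
      by (simp add: M_def x_def)
    have 3: "r * (\<Sum>l\<le>M. z l * Re (b 0 l)) = (\<Sum>l\<le>M. r ^ l * Re (b 0 l)) - Re (b 0 0)"
      unfolding M_def sum.atMost_Suc_shift by (simp add: z_def sum_distrib_left mult.assoc)
    have 4: "r * (\<Sum>l\<le>M. z l * Re (b M l)) = r ^ M * Re (b M M)"
    proof -
      have "(\<Sum>l\<le>M. z l * Re (b M l)) = (\<Sum>l\<in>{M}. z l * Re (b M l))"
        by (intro sum.mono_neutral_right) (auto simp: upper)
      then show ?thesis by (simp add: z_def M_def)
    qed
    have "r * B d z = (r * (\<Sum>l\<le>M. z l * Re (b 0 l))) - r ^ M * (r * (\<Sum>l\<le>M. z l * Re (b M l)))"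
      by (simp only: Bd) (simp add: algebra_simps)
    then show ?thesis
      by (simp only: Bd 1 2 3 4) (simp add: P_def M_def algebra_simps)
  qed
  finally have P: "B x x - r\<^sup>2 * B z z = P" .
  show "(1 - r) * P \<le> (1 + r) * Q" "(1 - r) * Q \<le> (1 + r) * P"
    using quad unfolding P Q by blast+
qed

text \<open>Let the truncation length tend to infinity: the moments are uniformly bounded, so every
  term carrying \<open>r ^ M\<close> tends to zero.\<close>

lemma harnack:
  assumes r: "0 \<le> r" "r < 1"
  defines "f \<equiv> (\<Sum>l. r ^ l * Re (b 0 l))"
  shows "(1 - r) / (1 + r) * Re (b 0 0) \<le> f" and "f \<le> (1 + r) / (1 - r) * Re (b 0 0)"
proof -
  let ?c = "2 * Re (b 0 0)"
  have rM: "(\<lambda>M. r ^ M) \<longlonglongrightarrow> 0" using r by (intro LIMSEQ_realpow_zero)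
  have S: "(\<lambda>M. \<Sum>l\<le>M. r ^ l * Re (b 0 l)) \<longlonglongrightarrow> f"
    unfolding f_def by (rule summable_LIMSEQ' [OF summable_row [OF r]])
  have E: "(\<lambda>M. r ^ M * (\<Sum>k\<le>M. r ^ k * Re (b k M))) \<longlonglongrightarrow> 0"
  proof (rule Lim_null_comparison)
    have "\<bar>\<Sum>k\<le>M. r ^ k * Re (b k M)\<bar> \<le> ?c / (1 - r)" for M
    proof -
      have "\<bar>\<Sum>k\<le>M. r ^ k * Re (b k M)\<bar> \<le> (\<Sum>k\<le>M. \<bar>r ^ k * Re (b k M)\<bar>)" by (rule sum_abs)
      also have "\<dots> \<le> (\<Sum>k\<le>M. r ^ k * ?c)"
        using r abs_Re_le by (intro sum_mono) (simp add: abs_mult mult_left_mono)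
      also have "\<dots> = (\<Sum>k\<le>M. r ^ k) * ?c" by (rule sum_distrib_right [symmetric])
      also have "\<dots> \<le> (1 / (1 - r)) * ?c"
      proof (rule mult_right_mono)
        have "(\<Sum>k\<le>M. r ^ k) \<le> (\<Sum>k. r ^ k)"
          using r by (intro sum_le_suminf summable_geometric) auto
        then show "(\<Sum>k\<le>M. r ^ k) \<le> 1 / (1 - r)" using r by (simp add: suminf_geometric)
      qed (use diag_nonneg [of 0] in simp)
      finally show ?thesis by simp
    qed
    then show "\<forall>\<^sub>F M in sequentially. norm (r ^ M * (\<Sum>k\<le>M. r ^ k * Re (b k M))) \<le> r ^ M * (?c / (1 - r))"
      using r by (intro always_eventually allI) (simp add: abs_mult mult_left_mono del: times_divide_eq_right)
    show "(\<lambda>M. r ^ M * (?c / (1 - r))) \<longlonglongrightarrow> 0" by (rule tendsto_mult_left_zero [OF rM])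
  qed
  have bounded: "(\<lambda>M. g M * Re (b (h M) M)) \<longlonglongrightarrow> 0" if "g \<longlonglongrightarrow> 0" for g h
  proof (rule Lim_null_comparison)
    show "\<forall>\<^sub>F M in sequentially. norm (g M * Re (b (h M) M)) \<le> \<bar>g M\<bar> * ?c"
      using abs_Re_le by (intro always_eventually allI) (simp add: abs_mult mult_left_mono)
    show "(\<lambda>M. \<bar>g M\<bar> * ?c) \<longlonglongrightarrow> 0"
      by (intro tendsto_mult_left_zero tendsto_rabs_zero that)
  qed
  have P: "(\<lambda>M. (\<Sum>l\<le>M. r ^ l * Re (b 0 l)) - r ^ M * (\<Sum>k\<le>M. r ^ k * Re (b k M))) \<longlonglongrightarrow> f - 0"
    by (intro tendsto_diff S E)
  have Q: "(\<lambda>M. Re (b 0 0) - r ^ M * Re (b 0 M) + r ^ M * r ^ M * Re (b M M))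
      \<longlonglongrightarrow> Re (b 0 0) - 0 + 0"
    by (intro tendsto_add tendsto_diff tendsto_const bounded [of _ "\<lambda>_. 0"]
        bounded [of _ "\<lambda>M. M"] rM tendsto_mult_zero)
  \<comment> \<open>The sequences are shifted by \<open>LIMSEQ_Suc\<close> because the finite
    estimate is stated for \<open>M = Suc N\<close>.\<close>
  have "(1 - r) * (f - 0) \<le> (1 + r) * (Re (b 0 0) - 0 + 0)"
    by (rule LIMSEQ_le [OF LIMSEQ_Suc [OF tendsto_mult_left [OF P]]
          LIMSEQ_Suc [OF tendsto_mult_left [OF Q]]])
      (use harnack_partial(1) [OF r] in blast)
  then show "f \<le> (1 + r) / (1 - r) * Re (b 0 0)"
    using r by (simp add: pos_le_divide_eq mult.commute)
  have "(1 - r) * (Re (b 0 0) - 0 + 0) \<le> (1 + r) * (f - 0)"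
    by (rule LIMSEQ_le [OF LIMSEQ_Suc [OF tendsto_mult_left [OF Q]]
          LIMSEQ_Suc [OF tendsto_mult_left [OF P]]])
      (use harnack_partial(2) [OF r] in blast)
  then show "(1 - r) / (1 + r) * Re (b 0 0) \<le> f"
    using r by (simp add: pos_divide_le_eq mult.commute)
qed

end

section \<open>Positivity of the multi-Toeplitz form\<close>

lemma word_op_Nil [simp]: "word_op X [] = id_blinfun"
  and word_op_Cons: "word_op X (i # \<alpha>) = X i o\<^sub>L word_op X \<alpha>"
  by (simp_all add: word_op_def)

lemma word_op_append: "word_op X (\<alpha> @ \<beta>) = word_op X \<alpha> o\<^sub>L word_op X \<beta>"
  by (induction \<alpha>) (auto simp: word_op_Cons intro!: blinfun_eqI)

lemma word_op_scaleR: "word_op (\<lambda>i. r *\<^sub>R X i) \<alpha> = r ^ length \<alpha> *\<^sub>R word_op X \<alpha>"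
  by (induction \<alpha>) (auto simp: word_op_Cons blinfun.scaleR_left blinfun.scaleR_right intro!: blinfun_eqI)

lemma word_op_zero: "\<alpha> \<noteq> [] \<Longrightarrow> word_op (\<lambda>i. 0) \<alpha> = 0"
  by (cases \<alpha>) (auto simp: word_op_Cons intro!: blinfun_eqI)

lemma clinear_word_op: "(\<And>i. X i \<in> clinear_ops) \<Longrightarrow> word_op X \<alpha> \<in> clinear_ops"
  by (induction \<alpha>) (simp_all add: word_op_Cons clinear_compose)

lemma finite_words_eq [simp]: "finite {\<alpha> :: 'n::finite list. length \<alpha> = k}"
  using finite_lists_length_eq [of "UNIV :: 'n set" k] by simp

lemma finite_words_le [simp]: "finite {\<alpha> :: 'n::finite list. length \<alpha> \<le> k}"
  using finite_lists_length_le [of "UNIV :: 'n set" k] by simp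

lemma finite_words_less [simp]: "finite {\<alpha> :: 'n::finite list. length \<alpha> < k}"
  by (rule finite_subset [OF _ finite_words_le [of k]]) auto

text \<open>
  The coefficient \<open>F \<gamma>\<close> in position \<open>(\<alpha>, \<gamma>\<alpha>)\<close>: the analytic half of the multi-Toeplitz matrix
  of \<open>u\<close> on the full Fock space.
\<close>

definition toeplitz_form ::
  "('n list \<Rightarrow> ('e::chilbert_space \<Rightarrow>\<^sub>L 'e)) \<Rightarrow> 'n list \<Rightarrow> 'n list \<Rightarrow> 'e \<Rightarrow> 'e \<Rightarrow> complex"
  where "toeplitz_form F \<alpha> \<beta> y y' =
    (if drop (length \<beta> - length \<alpha>) \<beta> = \<alpha>
     then cinner (F (take (length \<beta> - length \<alpha>) \<beta>) y) y' else 0)"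

lemma toeplitz_form_scale:
  assumes "\<And>\<alpha>. F \<alpha> \<in> clinear_ops"
  shows "toeplitz_form F \<alpha> \<beta> (c *\<^sub>C y) (d *\<^sub>C y') = c * cnj d * toeplitz_form F \<alpha> \<beta> y y'"
  by (simp add: toeplitz_form_def clinear_opsD [OF assms] cinner_scaleC_left cinner_scaleC_right)

lemma toeplitz_form_append:
  fixes F :: "'n list \<Rightarrow> ('e::chilbert_space \<Rightarrow>\<^sub>L 'e)"
  shows "toeplitz_form F \<alpha> (\<delta> @ \<alpha>) y y' = cinner (F \<delta> y) y'"
  by (simp add: toeplitz_form_def)

text \<open>Matching of suffixes starts at the last letter. This is the statement that the right
  creation operators are isometries with orthogonal ranges for the form.\<close>

lemma toeplitz_form_snoc:
  "toeplitz_form F (\<alpha> @ [i]) (\<beta> @ [j]) y y' = (if i = j then toeplitz_form F \<alpha> \<beta> y y' else 0)"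
  by (auto simp: toeplitz_form_def)

lemma toeplitz_form_length: "length \<beta> < length \<alpha> \<Longrightarrow> toeplitz_form F \<alpha> \<beta> y y' = 0"
  by (auto simp: toeplitz_form_def)

text \<open>At most one word \<gamma> satisfies \<open>\<gamma> @ \<alpha> = \<beta>\<close>, and
  its length is at most \<open>N\<close>.\<close>

lemma toeplitz_form_conv_sum:
  fixes \<alpha> \<beta> :: "'n::finite list" and F :: "'n list \<Rightarrow> ('e::chilbert_space \<Rightarrow>\<^sub>L 'e)"
  assumes "length \<beta> \<le> N"
  shows "(\<Sum>k\<le>N. \<Sum>\<gamma> | length \<gamma> = k. if \<gamma> @ \<alpha> = \<beta> then cinner (F \<gamma> y) y' else 0)
    = toeplitz_form F \<alpha> \<beta> y y'"
proof (cases "drop (length \<beta> - length \<alpha>) \<beta> = \<alpha>")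
  case True
  define \<delta> where "\<delta> = take (length \<beta> - length \<alpha>) \<beta>"
  have \<beta>: "\<beta> = \<delta> @ \<alpha>" using True append_take_drop_id [of "length \<beta> - length \<alpha>" \<beta>]
    by (simp add: \<delta>_def)
  have "(\<Sum>\<gamma> | length \<gamma> = k. if \<gamma> @ \<alpha> = \<beta> then cinner (F \<gamma> y) y' else 0)
      = (if k = length \<delta> then cinner (F \<delta> y) y' else 0)" for k
    by (auto simp: \<beta> intro!: sum.neutral)
  then show ?thesis using assms by (simp add: \<beta> toeplitz_form_append)
next
  case False
  then have "\<gamma> @ \<alpha> \<noteq> \<beta>" for \<gamma> by auto
  then show ?thesis using False by (simp add: toeplitz_form_def)
qed

section \<open>Finite-rank models of the left creation operators\<close>

definition rank_one :: "'a::chilbert_space \<Rightarrow> 'b::chilbert_space \<Rightarrow> 'a \<Rightarrow>\<^sub>L 'b"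
  where "rank_one u v = Blinfun (\<lambda>x. cinner x u *\<^sub>C v)"

lemma rank_one_apply: "rank_one u v x = cinner x u *\<^sub>C v"
proof -
  have "bounded_linear (\<lambda>x. cinner x u *\<^sub>C v)"
    by (rule bounded_linear_compose [OF scaleC.bounded_linear_left cinner.bounded_linear_left])
  then show ?thesis by (simp add: rank_one_def bounded_linear_Blinfun_apply)
qed

text \<open>The sum \<open>P\<close> satisfies \<open>cinner P P = cinner x P\<close>;
  Cauchy-Schwarz then bounds its norm.\<close>

lemma bessel:
  fixes f :: "'i \<Rightarrow> 'a::chilbert_space"
  assumes "finite I" "\<And>p q. p \<in> I \<Longrightarrow> q \<in> I \<Longrightarrow> cinner (f p) (f q) = (if p = q then 1 else 0)"
  shows "norm (\<Sum>p\<in>I. cinner x (f p) *\<^sub>C f p) \<le> norm x"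
proof -
  define P where "P = (\<Sum>p\<in>I. cinner x (f p) *\<^sub>C f p)"
  have "cinner P (f q) = cinner x (f q)" if "q \<in> I" for q
  proof -
    have "cinner P (f q) = (\<Sum>p\<in>I. if p = q then cinner x (f p) else 0)"
      unfolding P_def cinner.sum_left cinner_scaleC_left
      by (intro sum.cong refl) (use that assms(2) in auto)
    then show ?thesis using that assms(1) by simp
  qed
  moreover have "cinner z P = (\<Sum>p\<in>I. cnj (cinner x (f p)) * cinner z (f p))" for z
    by (simp add: P_def cinner.sum_right cinner_scaleC_right)
  ultimately have "cinner P P = cinner x P" by simp
  then have "norm P * norm P \<le> norm x * norm P"
    using cmod_cinner_le [of x P] by (metis cinner_self norm_of_real abs_of_nonneg
        power2_eq_square zero_le_power2)
  then show ?thesis unfolding P_def [symmetric]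
    by (cases "P = 0") (simp_all add: mult_le_cancel_right)
qed

text \<open>
  The compressions of the left creation operators to words of length at most \<open>N\<close>; only a finite
  orthonormal family is required, so they act on any infinite-dimensional space.
\<close>

locale truncated_creation =
  fixes e :: "'n::finite list \<Rightarrow> 'k::chilbert_space" and N :: nat
  assumes orthonormal: "length \<alpha> \<le> N \<Longrightarrow> length \<beta> \<le> N \<Longrightarrow>
    cinner (e \<alpha>) (e \<beta>) = (if \<alpha> = \<beta> then 1 else 0)"
begin

definition L :: "'n \<Rightarrow> 'k \<Rightarrow>\<^sub>L 'k"
  where "L i = (\<Sum>\<alpha> | length \<alpha> < N. rank_one (e \<alpha>) (e (i # \<alpha>)))"

lemma L_apply: "L i x = (\<Sum>\<alpha> | length \<alpha> < N. cinner x (e \<alpha>) *\<^sub>C e (i # \<alpha>))"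
  by (simp add: L_def blinfun.sum_left rank_one_apply)

lemma L_basis: "length \<beta> \<le> N \<Longrightarrow> L i (e \<beta>) = (if length \<beta> < N then e (i # \<beta>) else 0)"
proof -
  assume \<beta>: "length \<beta> \<le> N"
  have "L i (e \<beta>) = (\<Sum>\<alpha> | length \<alpha> < N. if \<beta> = \<alpha> then e (i # \<alpha>) else 0)"
    unfolding L_apply using \<beta> by (intro sum.cong) (auto simp: orthonormal scaleC.zero_left)
  then show ?thesis by simp
qed

lemma clinear_L: "L i \<in> clinear_ops"
  by (simp add: clinear_ops_def L_apply cinner_scaleC_left scaleC.sum_right scaleC_scaleC)

lemma adj_L_apply: "adj (L i) x = (\<Sum>\<alpha> | length \<alpha> < N. cinner x (e (i # \<alpha>)) *\<^sub>C e \<alpha>)"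
proof (rule cinner_eqI)
  fix z
  show "cinner z (adj (L i) x) = cinner z (\<Sum>\<alpha> | length \<alpha> < N. cinner x (e (i # \<alpha>)) *\<^sub>C e \<alpha>)"
    by (simp add: cinner_adj_right [OF clinear_L] L_apply cinner.sum_left cinner.sum_right
        cinner_scaleC_left cinner_scaleC_right cinner_commute [of x] mult.commute)
qed

lemma word_op_L_basis:
  assumes "length \<alpha> \<le> N"
  shows "word_op L \<gamma> (e \<alpha>) = (if length \<gamma> + length \<alpha> \<le> N then e (\<gamma> @ \<alpha>) else 0)"
  by (induction \<gamma>) (use assms in \<open>auto simp: word_op_Cons L_basis\<close>)

text \<open>Nilpotency turns the series of a free holomorphic function at multiples of
  \<open>L\<close> into a finite sum.\<close>

lemma word_op_L_eq_0:
  assumes "N < length \<gamma>"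
  shows "word_op L \<gamma> = 0"
proof (rule blinfun_eqI)
  fix x
  obtain \<delta> i where \<gamma>: "\<gamma> = \<delta> @ [i]" using assms by (cases \<gamma> rule: rev_cases) auto
  \<comment> \<open>The last letter of \<gamma> acts first and lands in basis vectors of length at
    least 1; the remaining \<open>N\<close> or more letters push these past length
    \<open>N\<close>.\<close>
  have "word_op L \<delta> (e (i # \<alpha>)) = 0" if "length \<alpha> < N" for \<alpha>
    using that assms by (subst word_op_L_basis) (auto simp: \<gamma>)
  then show "word_op L \<gamma> x = blinfun_apply 0 x"
    by (simp add: \<gamma> word_op_append word_op_Cons L_apply blinfun.sum_right
        clinear_opsD [OF clinear_word_op [OF clinear_L]] scaleC.zero_right)
qed

text \<open>The sum is the orthogonal projection onto the span of the \<open>e\<close> at nonempty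
  words of length at most \<open>N\<close>, so Bessel's inequality applies.\<close>

lemma norm_L_le: "norm (\<Sum>i\<in>UNIV. L i o\<^sub>L adj (L i)) \<le> 1"
proof (rule norm_blinfun_bound)
  fix x
  have "(\<Sum>i\<in>UNIV. L i o\<^sub>L adj (L i)) x
      = (\<Sum>i\<in>UNIV. \<Sum>\<alpha> | length \<alpha> < N. cinner x (e (i # \<alpha>)) *\<^sub>C e (i # \<alpha>))"
    by (simp add: blinfun.sum_left adj_L_apply blinfun.sum_right clinear_opsD [OF clinear_L] L_basis)
  also have "\<dots> = (\<Sum>p\<in>UNIV \<times> {\<alpha>. length \<alpha> < N}.
      cinner x (e (fst p # snd p)) *\<^sub>C e (fst p # snd p))"
    by (simp add: sum.cartesian_product case_prod_unfold)
  also have "norm \<dots> \<le> norm x"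
    by (rule bessel) (auto simp: orthonormal prod_eq_iff)
  finally show "norm ((\<Sum>i\<in>UNIV. L i o\<^sub>L adj (L i)) x) \<le> 1 * norm x" by simp
qed simp

lemma scaled_L_in_row_ball:
  assumes "0 \<le> s" "s < 1"
  shows "(\<lambda>i. s *\<^sub>R L i) \<in> row_ball"
proof -
  have "adj (s *\<^sub>R L i) = s *\<^sub>R adj (L i)" for i
    by (rule adj_unique)
      (simp add: blinfun.scaleR_left cinner.scaleR_left cinner.scaleR_right cinner_adj_right clinear_L)
  then have "(s *\<^sub>R L i) o\<^sub>L adj (s *\<^sub>R L i) = s\<^sup>2 *\<^sub>R (L i o\<^sub>L adj (L i))" for i
    by (auto simp: blinfun.scaleR_left blinfun.scaleR_right power2_eq_square intro!: blinfun_eqI)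
  then have "norm (\<Sum>i\<in>UNIV. (s *\<^sub>R L i) o\<^sub>L adj (s *\<^sub>R L i))
      = s\<^sup>2 * norm (\<Sum>i\<in>UNIV. L i o\<^sub>L adj (L i))"
    by (simp add: scaleR_sum_right [symmetric])
  also have "\<dots> \<le> s\<^sup>2" using norm_L_le mult_left_mono [of _ 1 "s\<^sup>2"] by simp
  also have "\<dots> < 1" using assms by (simp add: power_less_one_iff)
  finally show ?thesis by (simp add: row_ball_def clinear_scaleR clinear_L)
qed

end

section \<open>From positivity on the ball to positivity of the form\<close>

lemma cinner_Re_part:
  assumes "T \<in> clinear_ops"
  shows "cinner (((1/2) *\<^sub>R (adj T + T)) v) v = of_real (Re (cinner (T v) v))"
proof -
  have "cinner (adj T v) v = cnj (cinner (T v) v)"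
    using assms by (metis cinner_adj_left cinner_commute)
  then show ?thesis
    by (simp add: blinfun.scaleR_left blinfun.add_left cinner.scaleR_left cinner.add_left
        complex_eq_iff)
qed

lemma sum_swap4:
  "(\<Sum>k\<in>K. \<Sum>g\<in>L k. \<Sum>p\<in>S. \<Sum>q\<in>T. f k g p q) = (\<Sum>p\<in>S. \<Sum>q\<in>T. \<Sum>k\<in>K. \<Sum>g\<in>L k. f k g p q)"
proof -
  have "(\<Sum>g\<in>L k. \<Sum>p\<in>S. \<Sum>q\<in>T. f k g p q) = (\<Sum>p\<in>S. \<Sum>q\<in>T. \<Sum>g\<in>L k. f k g p q)" for k
    by (subst sum.swap, rule sum.cong [OF refl], rule sum.swap)
  then have "(\<Sum>k\<in>K. \<Sum>g\<in>L k. \<Sum>p\<in>S. \<Sum>q\<in>T. f k g p q)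
      = (\<Sum>k\<in>K. \<Sum>p\<in>S. \<Sum>q\<in>T. \<Sum>g\<in>L k. f k g p q)" by simp
  also have "\<dots> = (\<Sum>p\<in>S. \<Sum>q\<in>T. \<Sum>k\<in>K. \<Sum>g\<in>L k. f k g p q)"
    by (subst sum.swap, rule sum.cong [OF refl], rule sum.swap)
  finally show ?thesis .
qed

text \<open>Evaluate Re F at \<open>s *\<^sub>R L i\<close> on the vector with component
  \<open>y p\<close> at the basis vector \<open>e (a p)\<close>. Only the \<gamma> with
  \<open>\<gamma> @ a p = a q\<close> survive, each with weight s to its length.\<close>

lemma toeplitz_form_nonneg_aux:
  fixes tK :: "'k::chilbert_space \<Rightarrow> 'e::chilbert_space \<Rightarrow> 'ke::chilbert_space"
    and F :: "'n::finite list \<Rightarrow> ('e \<Rightarrow>\<^sub>L 'e)" and a :: "'s \<Rightarrow> 'n list" and s :: real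
  assumes "hilbert_tensor tK" and F: "\<And>\<alpha>. F \<alpha> \<in> clinear_ops"
    and pos: "\<And>X. X \<in> row_ball \<Longrightarrow> op_le 0 (Re_free_hol tK F X)"
    and "truncated_creation (e :: 'n list \<Rightarrow> 'k) N"
    and N: "\<And>p. p \<in> S \<Longrightarrow> length (a p) \<le> N"
    and s: "0 \<le> s" "s < 1"
  shows "0 \<le> Re (\<Sum>p\<in>S. \<Sum>q\<in>S. of_real s ^ (length (a q) - length (a p)) *
    toeplitz_form F (a p) (a q) (y p) (y q))"
proof -
  interpret K: hilbert_tensor tK by fact
  interpret truncated_creation e N by fact
  define X where "X i = s *\<^sub>R L i" for i
  have X: "X \<in> row_ball" using scaled_L_in_row_ball [OF s] by (simp add: X_def [abs_def])
  have wX: "word_op X \<gamma> = s ^ length \<gamma> *\<^sub>R word_op L \<gamma>" for \<gamma>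
    unfolding X_def [abs_def] by (rule word_op_scaleR)
  have cX: "word_op X \<gamma> \<in> clinear_ops" for \<gamma>
    by (simp add: wX clinear_scaleR clinear_word_op clinear_L)
  define T where "T = (\<Sum>k\<le>N. \<Sum>\<gamma> | length \<gamma> = k. tensor_op tK (word_op X \<gamma>) (F \<gamma>))"
  have "free_hol_eval tK F X = T"
    unfolding free_hol_eval_def T_def
    by (rule suminf_finite) (auto intro!: sum.neutral simp: wX word_op_L_eq_0)
  then have Re: "Re_free_hol tK F X = (1/2) *\<^sub>R (adj T + T)" by (simp add: Re_free_hol_def)
  have T: "T \<in> clinear_ops"
    unfolding T_def by (intro clinear_sum K.clinear_tensor_op cX F)
  define v where "v = (\<Sum>p\<in>S. tK (e (a p)) (y p))"
  have "cinner (((1/2) *\<^sub>R (adj T + T)) v) v \<in> \<real>\<^sub>\<ge>\<^sub>0"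
    using pos [OF X] unfolding op_le_def Re by simp
  then have "0 \<le> Re (cinner (T v) v)"
    unfolding cinner_Re_part [OF T] by (simp add: complex_nonneg_Reals_iff)
  also have "cinner (T v) v = (\<Sum>k\<le>N. \<Sum>\<gamma> | length \<gamma> = k. \<Sum>p\<in>S. \<Sum>q\<in>S.
      cinner (word_op X \<gamma> (e (a p))) (e (a q)) * cinner (F \<gamma> (y p)) (y q))"
  proof -
    have "cinner (tensor_op tK (word_op X \<gamma>) (F \<gamma>) v) v = (\<Sum>p\<in>S. \<Sum>q\<in>S.
        cinner (word_op X \<gamma> (e (a p))) (e (a q)) * cinner (F \<gamma> (y p)) (y q))" for \<gamma>
      unfolding v_def by (rule K.cinner_tensor_op_sum [OF cX F])
    then show ?thesis by (simp add: T_def blinfun.sum_left cinner.sum_left)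
  qed
  also have "\<dots> = (\<Sum>p\<in>S. \<Sum>q\<in>S. \<Sum>k\<le>N. \<Sum>\<gamma> | length \<gamma> = k.
      cinner (word_op X \<gamma> (e (a p))) (e (a q)) * cinner (F \<gamma> (y p)) (y q))"
    by (rule sum_swap4)
  also have "\<dots> = (\<Sum>p\<in>S. \<Sum>q\<in>S. of_real s ^ (length (a q) - length (a p)) *
      toeplitz_form F (a p) (a q) (y p) (y q))"
  proof (intro sum.cong refl)
    fix p q assume pq: "p \<in> S" "q \<in> S"
    \<comment> \<open>Truncated subtraction is harmless: if \<open>a q\<close> is shorter than
      \<open>a p\<close>, the form itself is zero.\<close>
    let ?m = "length (a q) - length (a p)"
    have "cinner (word_op X \<gamma> (e (a p))) (e (a q)) * cinner (F \<gamma> (y p)) (y q)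
      = of_real s ^ ?m * (if \<gamma> @ a p = a q then cinner (F \<gamma> (y p)) (y q) else 0)" for \<gamma>
    proof (cases "length \<gamma> + length (a p) \<le> N")
      case True
      then have "cinner (word_op X \<gamma> (e (a p))) (e (a q))
          = (of_real s ^ length \<gamma>) * (if \<gamma> @ a p = a q then 1 else 0)"
        using pq N by (simp add: wX blinfun.scaleR_left cinner.scaleR_left word_op_L_basis
            orthonormal scaleR_conv_of_real)
      moreover have "length \<gamma> = ?m" if "\<gamma> @ a p = a q" using arg_cong [OF that, of length] by simp
      ultimately show ?thesis by auto
    next
      case False
      then have "\<gamma> @ a p \<noteq> a q" using N [OF pq(2)] by (metis length_append)
      with False show ?thesis
        using pq N by (simp add: wX blinfun.scaleR_left word_op_L_basis cinner.zero_left)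
    qed
    then show "(\<Sum>k\<le>N. \<Sum>\<gamma> | length \<gamma> = k.
        cinner (word_op X \<gamma> (e (a p))) (e (a q)) * cinner (F \<gamma> (y p)) (y q))
      = of_real s ^ ?m * toeplitz_form F (a p) (a q) (y p) (y q)"
      using toeplitz_form_conv_sum [OF N [OF pq(2)], of "a p" F "y p" "y q"]
      by (simp only: sum_distrib_left [symmetric])
  qed
  finally show ?thesis .
qed

text \<open>The open ball admits only \<open>s < 1\<close>; for a fixed finite family the weighted
  sum is continuous in \<open>s\<close>, and \<open>s\<close> tends to 1 from the left.\<close>

lemma toeplitz_form_nonneg:
  fixes tK :: "'k::chilbert_space \<Rightarrow> 'e::chilbert_space \<Rightarrow> 'ke::chilbert_space"
    and F :: "'n::finite list \<Rightarrow> ('e \<Rightarrow>\<^sub>L 'e)" and a :: "'s \<Rightarrow> 'n list"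
  assumes "hilbert_tensor tK" and inf: "infinite_cdim TYPE('k)"
    and F: "\<And>\<alpha>. F \<alpha> \<in> clinear_ops"
    and pos: "\<And>X. X \<in> row_ball \<Longrightarrow> op_le 0 (Re_free_hol tK F X)"
    and S: "finite S"
  shows "0 \<le> Re (\<Sum>p\<in>S. \<Sum>q\<in>S. toeplitz_form F (a p) (a q) (y p) (y q))"
proof -
  \<comment> \<open>A convenient common bound for the lengths of the finitely many words.\<close>
  define N where "N = (\<Sum>p\<in>S. length (a p))"
  have N: "length (a p) \<le> N" if "p \<in> S" for p
    unfolding N_def using that S by (intro member_le_sum) auto
  obtain e :: "'n list \<Rightarrow> 'k" where "truncated_creation e N"
    using orthonormal_family_exists [OF inf finite_words_le [of N, where 'n = 'n]]
    unfolding truncated_creation_def by auto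
  define h where "h s = Re (\<Sum>p\<in>S. \<Sum>q\<in>S. of_real s ^ (length (a q) - length (a p)) *
    toeplitz_form F (a p) (a q) (y p) (y q))" for s :: real
  have "(h \<longlongrightarrow> h 1) (at_left 1)"
    unfolding h_def by (intro tendsto_intros)
  moreover have "\<forall>\<^sub>F s in at_left 1. 0 \<le> h s"
  proof -
    have "\<forall>\<^sub>F s in at_left 1. (s::real) \<in> {0<..<1}" by (rule eventually_at_left_real) simp
    then show ?thesis
    proof eventually_elim
      case (elim s)
      then show ?case
        unfolding h_def using N
        by (intro toeplitz_form_nonneg_aux [OF assms(1) F pos \<open>truncated_creation e N\<close>]) auto
    qed
  qed
  ultimately have "0 \<le> h 1" by (rule tendsto_lowerbound) simp
  then show ?thesis by (simp add: h_def)
qed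

section \<open>Row isometries\<close>

lemma isometry_clinear: "V \<in> isometries \<Longrightarrow> V \<in> clinear_ops"
  by (simp add: isometries_def)

lemma isometry_cinner:
  assumes V: "V \<in> isometries"
  shows "cinner (V x) (V y) = cinner x y"
proof -
  have "inner (V x) (V y) = inner x y" for x y
  proof -
    have "norm (V (x + y)) = norm (x + y)" "norm (V x) = norm x" "norm (V y) = norm y"
      using V by (simp_all add: isometries_def)
    then show ?thesis
      by (simp add: blinfun.add_right norm_eq_sqrt_inner inner_add_left inner_add_right inner_commute)
  qed
  from this [of x y] this [of x "\<i> *\<^sub>C y"] show ?thesis
    by (simp add: cinner_conv_inner clinear_opsD [OF isometry_clinear [OF V]])
qed

lemma sum_words_le:
  fixes h :: "'n::finite list \<times> 'i \<Rightarrow> 'c::comm_monoid_add"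
  assumes "finite I"
  shows "(\<Sum>p\<in>{\<alpha>. length \<alpha> \<le> N} \<times> I. h p) = (\<Sum>k\<le>N. \<Sum>p\<in>{\<alpha>. length \<alpha> = k} \<times> I. h p)"
proof -
  have "(\<Sum>p\<in>{\<alpha>. length \<alpha> \<le> N} \<times> I. h p)
      = (\<Sum>k\<le>N. \<Sum>p | p \<in> {\<alpha>. length \<alpha> \<le> N} \<times> I \<and> length (fst p) = k. h p)"
    by (rule sum.group [symmetric]) (use assms in auto)
  also have "\<dots> = (\<Sum>k\<le>N. \<Sum>p\<in>{\<alpha>. length \<alpha> = k} \<times> I. h p)"
    by (intro sum.cong refl) auto
  finally show ?thesis .
qed

lemma sum_words_Suc:
  fixes h :: "'n::finite list \<times> 'i \<Rightarrow> 'c::comm_monoid_add"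
  shows "(\<Sum>p\<in>{\<alpha>. length \<alpha> = Suc k} \<times> I. h p)
    = (\<Sum>m\<in>UNIV. \<Sum>p\<in>{\<alpha>. length \<alpha> = k} \<times> I. h (fst p @ [m], snd p))"
proof -
  have "(\<Sum>p\<in>{\<alpha>. length \<alpha> = Suc k} \<times> I. h p)
      = (\<Sum>(m, p)\<in>UNIV \<times> ({\<alpha>. length \<alpha> = k} \<times> I). h (fst p @ [m], snd p))"
    by (rule sum.reindex_bij_witness [where j = "\<lambda>(\<alpha>, i). (last \<alpha>, butlast \<alpha>, i)"
          and i = "\<lambda>(m, \<alpha>, i). (\<alpha> @ [m], i)"]) (auto simp: length_Suc_conv_rev)
  then show ?thesis by (simp add: sum.cartesian_product)
qed

locale row_isometry =
  fixes V :: "'n::finite \<Rightarrow> 'g::chilbert_space \<Rightarrow>\<^sub>L 'g"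
  assumes isometry: "V i \<in> isometries"
    and orthogonal: "i \<noteq> j \<Longrightarrow> cinner (V i x) (V j y) = 0"
begin

lemma clinear_V: "V i \<in> clinear_ops"
  by (rule isometry_clinear [OF isometry])

text \<open>The orthogonal projection onto the complement of the ranges of all
  \<open>V m\<close>.\<close>

definition defect :: "'g \<Rightarrow> 'g"
  where "defect u = u - (\<Sum>m\<in>UNIV. V m (adj (V m) u))"

lemma cinner_V: "cinner (V i x) (V j y) = (if i = j then cinner x y else 0)"
  by (simp add: isometry_cinner [OF isometry] orthogonal)

text \<open>It exhibits the loss of inner product under the adjoints of the \<open>V m\<close> as a
  Gram matrix, the form needed for the Schur product argument.\<close>

lemma cinner_defect:
  "cinner (defect u) (defect v) = cinner u v - (\<Sum>m\<in>UNIV. cinner (adj (V m) u) (adj (V m) v))"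
proof -
  let ?s = "\<Sum>m\<in>UNIV. cinner (adj (V m) u) (adj (V m) v)"
  have "cinner u (\<Sum>m\<in>UNIV. V m (adj (V m) v)) = ?s"
    by (simp add: cinner.sum_right cinner_adj_left clinear_V)
  moreover have "cinner (\<Sum>m\<in>UNIV. V m (adj (V m) u)) v = ?s"
    by (simp add: cinner.sum_left cinner_adj_right clinear_V)
  moreover have "cinner (\<Sum>m\<in>UNIV. V m (adj (V m) u)) (\<Sum>m\<in>UNIV. V m (adj (V m) v)) = ?s"
    by (simp add: double_sum_cinner cinner_V)
  ultimately show ?thesis by (simp add: defect_def cinner.diff_left cinner.diff_right)
qed

lemma adj_word_snoc: "adj (word_op V (\<alpha> @ [m])) x = adj (V m) (adj (word_op V \<alpha>) x)"
proof -
  have "word_op V (\<alpha> @ [m]) = word_op V \<alpha> o\<^sub>L V m"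
    by (auto simp: word_op_append word_op_Cons intro!: blinfun_eqI)
  then show ?thesis by (simp add: adj_compose clinear_word_op clinear_V)
qed

end

section \<open>Moments of the contraction built from a row isometry and the multi-Toeplitz
  form\<close>

locale positive_toeplitz_form =
  fixes F :: "'n::finite list \<Rightarrow> ('e::chilbert_space \<Rightarrow>\<^sub>L 'e)"
  assumes clinear_F: "F \<alpha> \<in> clinear_ops"
    and toeplitz_nonneg: "finite (S :: ('n list \<times> nat) set) \<Longrightarrow>
      0 \<le> Re (\<Sum>p\<in>S. \<Sum>q\<in>S. toeplitz_form F (a p) (a q) (y p) (y q))"
begin

text \<open>Scalar weights \<open>d p\<close> can be absorbed into \<open>y p\<close>, so positivity
  of the form gives the hypothesis of the Schur product theorem.\<close>

lemma gram_toeplitz_nonneg: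
  fixes S :: "('n list \<times> nat) set" and g :: "'n list \<times> nat \<Rightarrow> 'g::chilbert_space"
  assumes "finite S"
  shows "0 \<le> Re (\<Sum>p\<in>S. \<Sum>q\<in>S. cinner (g p) (g q) * toeplitz_form F (a p) (a q) (y p) (y q))"
proof (rule schur_nonneg [OF assms])
  show "0 \<le> Re (\<Sum>p\<in>S. \<Sum>q\<in>S. d p * cnj (d q) * toeplitz_form F (a p) (a q) (y p) (y q))" for d
    using toeplitz_nonneg [OF assms, of a "\<lambda>p. d p *\<^sub>C y p"]
    by (simp add: toeplitz_form_scale clinear_F)
qed

end

locale dilated_vector = row_isometry V + positive_toeplitz_form F
  for V :: "'n::finite \<Rightarrow> 'g::chilbert_space \<Rightarrow>\<^sub>L 'g"
    and F :: "'n list \<Rightarrow> ('e::chilbert_space \<Rightarrow>\<^sub>L 'e)" +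
  fixes n :: nat and x :: "nat \<Rightarrow> 'g" and y :: "nat \<Rightarrow> 'e"
begin

definition W :: "nat \<Rightarrow> ('n list \<times> nat) set"
  where "W k = {\<alpha>. length \<alpha> = k} \<times> {..<n}"

text \<open>The first tensor factor of the component of Z^k \<xi> at a word of length k and summand
  \<open>i\<close>. Each application of \<open>Z\<close> appends a letter on the right and applies
  one more adjoint on the outside.\<close>

definition fock_vec :: "'n list \<times> nat \<Rightarrow> 'g"
  where "fock_vec p = adj (word_op V (fst p)) (x (snd p))"

definition fock_form :: "'n list \<times> nat \<Rightarrow> 'n list \<times> nat \<Rightarrow> complex"
  where "fock_form p q = toeplitz_form F (fst p) (fst q) (y (snd p)) (y (snd q))"

text \<open>
  The moments of the contraction \<open>Z = \<Sum>V\<^sub>m\<^sup>* \<otimes> R\<^sub>m\<close>, where the \<open>R\<^sub>m\<close> append a letter on the right,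
  at the vector \<open>\<Sum>x\<^sub>i \<otimes> y\<^sub>i\<close>.
\<close>

definition moment :: "nat \<Rightarrow> nat \<Rightarrow> complex"
  where "moment k l = (\<Sum>p\<in>W k. \<Sum>q\<in>W l. cinner (fock_vec p) (fock_vec q) * fock_form p q)"

text \<open>Stated for arbitrary \<open>g\<close> because it is used twice: with
  \<open>fock_vec\<close> for positivity and with the defects of \<open>fock_vec\<close> for
  contractivity.\<close>

lemma weighted_moments_nonneg:
  fixes g :: "'n list \<times> nat \<Rightarrow> 'g"
  shows "0 \<le> Re (\<Sum>k\<le>N. \<Sum>l\<le>N. c k * cnj (c l) * (\<Sum>p\<in>W k. \<Sum>q\<in>W l. cinner (g p) (g q) * fock_form p q))"
proof -
  define S where "S = {\<alpha> :: 'n list. length \<alpha> \<le> N} \<times> {..<n}"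
  define h where "h p = c (length (fst p)) *\<^sub>C g p" for p
  have S: "(\<Sum>p\<in>S. f p) = (\<Sum>k\<le>N. \<Sum>p\<in>W k. f p)" for f :: "'n list \<times> nat \<Rightarrow> complex"
    by (simp add: S_def W_def sum_words_le)
  have "0 \<le> Re (\<Sum>p\<in>S. \<Sum>q\<in>S. cinner (h p) (h q) * fock_form p q)"
    unfolding fock_form_def by (rule gram_toeplitz_nonneg) (simp add: S_def)
  also have "(\<Sum>p\<in>S. \<Sum>q\<in>S. cinner (h p) (h q) * fock_form p q)
      = (\<Sum>k\<le>N. \<Sum>p\<in>W k. \<Sum>l\<le>N. \<Sum>q\<in>W l. cinner (h p) (h q) * fock_form p q)"
    by (simp only: S)
  also have "\<dots> = (\<Sum>k\<le>N. \<Sum>p\<in>W k. \<Sum>l\<le>N. \<Sum>q\<in>W l.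
      c k * cnj (c l) * (cinner (g p) (g q) * fock_form p q))"
    by (intro sum.cong refl)
      (auto simp: h_def W_def cinner_scaleC_left cinner_scaleC_right mult_ac)
  also have "\<dots> = (\<Sum>k\<le>N. \<Sum>l\<le>N. \<Sum>p\<in>W k. \<Sum>q\<in>W l.
      c k * cnj (c l) * (cinner (g p) (g q) * fock_form p q))"
    by (rule sum.cong [OF refl], rule sum.swap)
  finally show ?thesis by (simp add: sum_distrib_left)
qed

text \<open>The contractivity of \<open>Z\<close>: the loss under \<open>Z\<close> is again a form
  of the same shape, with the defect projection applied to the first factor.\<close>

lemma moment_defect:
  "moment k l - moment (Suc k) (Suc l)
    = (\<Sum>p\<in>W k. \<Sum>q\<in>W l. cinner (defect (fock_vec p)) (defect (fock_vec q)) * fock_form p q)"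
proof -
  let ?s = "\<lambda>p m. (fst p @ [m], snd p)"
  have W_Suc: "(\<Sum>p\<in>W (Suc k). f p) = (\<Sum>m\<in>UNIV. \<Sum>p\<in>W k. f (?s p m))"
    for f :: "'n list \<times> nat \<Rightarrow> complex" and k
    unfolding W_def by (rule sum_words_Suc)
  have fock_vec: "fock_vec (?s p m) = adj (V m) (fock_vec p)" for p m
    by (simp add: fock_vec_def adj_word_snoc)
  have fock_form: "fock_form (?s p m) (?s q m') = (if m = m' then fock_form p q else 0)" for p q m m'
    by (simp add: fock_form_def toeplitz_form_snoc)
  have "moment (Suc k) (Suc l) = (\<Sum>m\<in>UNIV. \<Sum>p\<in>W k. \<Sum>m'\<in>UNIV. \<Sum>q\<in>W l.
      cinner (adj (V m) (fock_vec p)) (adj (V m') (fock_vec q)) * fock_form (?s p m) (?s q m'))"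
    by (simp only: moment_def W_Suc fock_vec)
  also have "\<dots> = (\<Sum>m\<in>UNIV. \<Sum>p\<in>W k. \<Sum>m'\<in>UNIV. if m = m' then
      \<Sum>q\<in>W l. cinner (adj (V m) (fock_vec p)) (adj (V m) (fock_vec q)) * fock_form p q else 0)"
    by (intro sum.cong refl) (simp add: fock_form)
  also have "\<dots> = (\<Sum>m\<in>UNIV. \<Sum>p\<in>W k. \<Sum>q\<in>W l.
      cinner (adj (V m) (fock_vec p)) (adj (V m) (fock_vec q)) * fock_form p q)"
    by simp
  also have "\<dots> = (\<Sum>p\<in>W k. \<Sum>q\<in>W l. \<Sum>m\<in>UNIV.
      cinner (adj (V m) (fock_vec p)) (adj (V m) (fock_vec q)) * fock_form p q)"
    by (subst sum.swap, rule sum.cong [OF refl], rule sum.swap)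
  finally show ?thesis
    by (simp add: moment_def cinner_defect left_diff_distrib sum_subtractf sum_distrib_right)
qed

sublocale contraction_moments moment
proof
  show "moment k l = 0" if "l < k" for k l
    unfolding moment_def using that
    by (intro sum.neutral ballI) (auto simp: W_def fock_form_def toeplitz_form_length)
  show "0 \<le> Re (\<Sum>k\<le>N. \<Sum>l\<le>N. c k * cnj (c l) * moment k l)" for N c
    unfolding moment_def by (rule weighted_moments_nonneg)
  show "0 \<le> Re (\<Sum>k\<le>N. \<Sum>l\<le>N. c k * cnj (c l) * (moment k l - moment (Suc k) (Suc l)))" for N c
    unfolding moment_defect by (rule weighted_moments_nonneg)
qed

text \<open>The link with the function: row 0 of the moments gives the quadratic forms of the
  homogeneous parts of F at \<open>V\<close>.\<close>

lemma moment_0: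
  "moment 0 l = (\<Sum>\<alpha> | length \<alpha> = l. \<Sum>i<n. \<Sum>j<n.
    cinner (word_op V \<alpha> (x i)) (x j) * cinner (F \<alpha> (y i)) (y j))"
proof -
  have W0: "W 0 = {[]} \<times> {..<n}" by (auto simp: W_def)
  have id: "adj id_blinfun = (id_blinfun :: 'g \<Rightarrow>\<^sub>L 'g)" by (rule adj_unique) simp
  have "moment 0 l = (\<Sum>i<n. \<Sum>\<alpha> | length \<alpha> = l. \<Sum>j<n. cinner (fock_vec ([], i)) (fock_vec (\<alpha>, j)) * fock_form ([], i) (\<alpha>, j))"
    unfolding moment_def W0 W_def sum.cartesian_product' by simp
  also have "\<dots> = (\<Sum>i<n. \<Sum>\<alpha> | length \<alpha> = l. \<Sum>j<n.
      cinner (word_op V \<alpha> (x i)) (x j) * cinner (F \<alpha> (y i)) (y j))"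
    by (intro sum.cong refl)
      (simp add: fock_vec_def fock_form_def id cinner_adj_right clinear_word_op clinear_V toeplitz_form_def)
  finally show ?thesis by (simp only: sum.swap [of _ "{..<n}" "{\<alpha>. length \<alpha> = l}"])
qed

end

section \<open>Operators of class \<open>C\<^sub>\<rho>\<close>\<close>

lemma adj_scaleR: "A \<in> clinear_ops \<Longrightarrow> adj (s *\<^sub>R A) = s *\<^sub>R adj A"
  by (rule adj_unique)
    (simp add: blinfun.scaleR_left cinner.scaleR_left cinner.scaleR_right cinner_adj_right)

lemma adj_sum:
  assumes "\<And>i. i \<in> I \<Longrightarrow> A i \<in> clinear_ops"
  shows "adj (\<Sum>i\<in>I. A i) = (\<Sum>i\<in>I. adj (A i))"
  by (rule adj_unique)
    (simp add: blinfun.sum_left cinner.sum_left cinner.sum_right cinner_adj_right assms)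

text \<open>Polarisation expresses \<open>cinner (T u) v\<close> through four quadratic values, and
  the parallelogram law adds up their bounds. It is needed because the moments control only
  quadratic forms, whereas convergence of the series is in norm.\<close>

lemma norm_le_numerical_radius:
  fixes T :: "'a::chilbert_space \<Rightarrow>\<^sub>L 'a"
  assumes T: "T \<in> clinear_ops" and w: "\<And>v. cmod (cinner (T v) v) \<le> w * (norm v)\<^sup>2" "0 \<le> w"
  shows "norm T \<le> 2 * w"
proof (rule norm_blinfun_bound)
  define q where "q v = cinner (T v) v" for v
  have polar: "4 * cinner (T u) v = q (u + v) - q (u - v) + \<i> * q (u + \<i> *\<^sub>C v) - \<i> * q (u - \<i> *\<^sub>C v)"
    for u v
    by (simp add: q_def blinfun.add_right blinfun.diff_right clinear_opsD [OF T] cinner.add_left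
        cinner.add_right cinner.diff_left cinner.diff_right cinner_scaleC_left cinner_scaleC_right
        algebra_simps)
  have bound: "cmod (cinner (T u) v) \<le> w * ((norm u)\<^sup>2 + (norm v)\<^sup>2)" for u v
  proof -
    have par: "(norm (u + v))\<^sup>2 + (norm (u - v))\<^sup>2 = 2 * (norm u)\<^sup>2 + 2 * (norm v)\<^sup>2" for u v :: 'a
      by (simp add: power2_norm_eq_inner inner_add_left inner_add_right inner_diff_left
          inner_diff_right inner_commute)
    have "4 * cmod (cinner (T u) v) = cmod (4 * cinner (T u) v)" by (simp add: norm_mult)
    also have "\<dots> \<le> cmod (q (u + v)) + cmod (q (u - v)) + cmod (q (u + \<i> *\<^sub>C v)) + cmod (q (u - \<i> *\<^sub>C v))"
      unfolding polar
      by (intro order_trans [OF norm_triangle_ineq4] order_trans [OF norm_triangle_ineq] add_mono)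
        (simp_all add: norm_mult)
    also have "\<dots> \<le> w * (norm (u + v))\<^sup>2 + w * (norm (u - v))\<^sup>2
        + w * (norm (u + \<i> *\<^sub>C v))\<^sup>2 + w * (norm (u - \<i> *\<^sub>C v))\<^sup>2"
      unfolding q_def by (intro add_mono w)
    also have "\<dots> = w * ((norm (u + v))\<^sup>2 + (norm (u - v))\<^sup>2)
        + w * ((norm (u + \<i> *\<^sub>C v))\<^sup>2 + (norm (u - \<i> *\<^sub>C v))\<^sup>2)"
      by (simp add: algebra_simps)
    also have "\<dots> = 4 * (w * ((norm u)\<^sup>2 + (norm v)\<^sup>2))"
      unfolding par by (simp add: norm_scaleC algebra_simps)
    finally show ?thesis by simp
  qed
  show "norm (T u) \<le> 2 * w * norm u" for u
  proof (cases "T u = 0")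
    case False
    \<comment> \<open>Rescaling \<open>T u\<close> to the norm of \<open>u\<close> balances the two
      squares in \<open>bound\<close>.\<close>
    define s where "s = norm u / norm (T u)"
    have s: "s * norm (T u) = norm u" "0 \<le> s" using False by (simp_all add: s_def)
    have "cmod (cinner (T u) (s *\<^sub>R T u)) = (s * norm (T u)) * norm (T u)"
      using s(2) by (simp add: cinner.scaleR_right cinner_self power2_eq_square norm_mult)
    then have "norm u * norm (T u) \<le> w * ((norm u)\<^sup>2 + (s * norm (T u))\<^sup>2)"
      using bound [of u "s *\<^sub>R T u"] s by simp
    then have "norm u * norm (T u) \<le> norm u * (2 * w * norm u)"
      by (simp add: s power2_eq_square algebra_simps)
    moreover have "0 < norm u" using False by (auto simp: blinfun.zero_right)
    ultimately show ?thesis by (simp only: mult_le_cancel_left_pos)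
  qed (use w in simp)
qed (use w in simp)

lemma (in hilbert_tensor) op_leI:
  fixes S T :: "'t \<Rightarrow>\<^sub>L 't"
  assumes "\<And>(n::nat) x y. \<exists>c\<ge>0. cinner ((T - S) (\<Sum>i<n. t (x i) (y i))) (\<Sum>i<n. t (x i) (y i))
    = complex_of_real c"
  shows "op_le S T"
proof -
  have "cinner ((T - S) v) v \<in> \<real>\<^sub>\<ge>\<^sub>0" for v
  proof (rule dense_induct [of "\<lambda>v. cinner ((T - S) v) v \<in> \<real>\<^sub>\<ge>\<^sub>0"])
    have "closed ((\<lambda>v. cinner ((T - S) v) v) -` \<real>\<^sub>\<ge>\<^sub>0)"
      by (intro closed_vimage closed_nonneg_Reals_complex cinner.continuous_on continuous_intros)
    then show "closed {v. cinner ((T - S) v) v \<in> \<real>\<^sub>\<ge>\<^sub>0}" by (simp add: vimage_def)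
    show "cinner ((T - S) (\<Sum>i<n. t (x i) (y i))) (\<Sum>i<n. t (x i) (y i)) \<in> \<real>\<^sub>\<ge>\<^sub>0" for n :: nat and x y
      using assms [where n = n and x = x and y = y] by auto
  qed
  then show ?thesis by (simp add: op_le_def)
qed

theorem theorem3p1:
  fixes tK :: "'k::chilbert_space \<Rightarrow> 'e::chilbert_space \<Rightarrow> 'ke::chilbert_space"
    and tH :: "'h::chilbert_space \<Rightarrow> 'e \<Rightarrow> 'he::chilbert_space"
    and A :: "'n::finite list \<Rightarrow> ('e \<Rightarrow>\<^sub>L 'e)"
    and X :: "'n \<Rightarrow> ('h \<Rightarrow>\<^sub>L 'h)"
    and \<rho> r :: real
  assumes "separable_space (euclidean :: 'k topology)" and "infinite_cdim TYPE('k)"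
    and "separable_space (euclidean :: 'e topology)"
    and "hilbert_tensor tK" and "hilbert_tensor tH"
    and "\<rho> > 0"
    and "positive_free_pluriharmonic tK A"
    and "0 \<le> r" and "r < 1"
    and "X \<in> C_class TYPE('g::chilbert_space) \<rho>"
  shows "let u = free_pluriharm_eval tH A in
      op_le (((1 - r * (2 * \<rho> - 1)) / (1 + r)) *\<^sub>R u (\<lambda>i. 0)) (u (\<lambda>i. r *\<^sub>R X i)) \<and>
      op_le (u (\<lambda>i. r *\<^sub>R X i)) (((1 + r * (2 * \<rho> - 1)) / (1 - r)) *\<^sub>R u (\<lambda>i. 0))"
proof -
  interpret H: hilbert_tensor tH by fact
  obtain F where F: "\<And>\<alpha>. F \<alpha> \<in> clinear_ops" and A: "A = Re_coeff F"
    and pos: "\<And>Y :: 'n \<Rightarrow> 'k \<Rightarrow>\<^sub>L 'k. Y \<in> row_ball \<Longrightarrow> op_le 0 (Re_free_hol tK F Y)"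
    using \<open>positive_free_pluriharmonic tK A\<close>
    unfolding positive_free_pluriharmonic_def free_holomorphic_def by blast
  obtain J :: "'h \<Rightarrow>\<^sub>L 'g" and V :: "'n \<Rightarrow> 'g \<Rightarrow>\<^sub>L 'g" where X: "\<And>i. X i \<in> clinear_ops"
    and J: "J \<in> isometries" and V: "\<And>i. V i \<in> isometries"
    and orth: "\<And>i j x y. i \<noteq> j \<Longrightarrow> cinner (V i x) (V j y) = 0"
    and dil: "\<And>\<alpha>. \<alpha> \<noteq> [] \<Longrightarrow> word_op X \<alpha> = \<rho> *\<^sub>R (adj J o\<^sub>L word_op V \<alpha> o\<^sub>L J)"
    using \<open>X \<in> C_class TYPE('g) \<rho>\<close> unfolding C_class_def by blast
  have V': "row_isometry V" by unfold_locales (fact V, fact orth)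
  have F': "positive_toeplitz_form F"
    by unfold_locales (fact F, rule toeplitz_form_nonneg [OF \<open>hilbert_tensor tK\<close>
          \<open>infinite_cdim TYPE('k)\<close> F pos])
  have dilated: "dilated_vector V F" using V' F' by (rule dilated_vector.intro)
  note rr = \<open>0 \<le> r\<close> \<open>r < 1\<close>
  have cX: "word_op X \<gamma> \<in> clinear_ops" for \<gamma> by (rule clinear_word_op [OF X])
  define T where "T k = (\<Sum>\<gamma> | length \<gamma> = k. tensor_op tH (word_op X \<gamma>) (F \<gamma>))" for k
  have cT: "T k \<in> clinear_ops" for k
    unfolding T_def by (intro clinear_sum H.clinear_tensor_op cX F)
  have T0: "T 0 = tensor_op tH id_blinfun (F [])" by (simp add: T_def)
  \<comment> \<open>The dilation contributes \<rho> only for nonempty words; in degree 0 the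
    isometry \<open>J\<close> preserves inner products. This asymmetry is the source of the \<rho>
    dependence of the final constants.\<close>
  have moments: "cinner (T k v) v = (if k = 0 then 1 else of_real \<rho>) * dilated_vector.moment V F n (\<lambda>i. J (x i)) y 0 k"
    if v: "v = (\<Sum>i<n. tH (x i) (y i))" for k and n :: nat and x y v
  proof -
    interpret dilated_vector V F n "\<lambda>i. J (x i)" y by (fact dilated)
    have "cinner (word_op X \<gamma> (x i)) (x j) = (if k = 0 then 1 else of_real \<rho>) *
        cinner (word_op V \<gamma> (J (x i))) (J (x j))" if "length \<gamma> = k" for \<gamma> i j
    proof (cases "\<gamma> = []")
      case True
      then show ?thesis using that by (simp add: isometry_cinner [OF J])
    next
      case False
      then have "k \<noteq> 0" using that by auto
      then show ?thesis
        by (simp add: dil False blinfun.scaleR_left cinner.scaleR_left scaleR_conv_of_real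
            cinner_adj_left isometry_clinear [OF J])
    qed
    then show ?thesis
      by (simp add: v T_def blinfun.sum_left cinner.sum_left [of _ "{\<gamma>. length \<gamma> = k}"]
          H.cinner_tensor_op_sum cX F moment_0 sum_distrib_left mult.assoc)
  qed
  \<comment> \<open>Large enough for both cases: \<open>norm (T 0)\<close> in degree 0 and
    \<open>2 * \<rho> * norm (T 0)\<close> in positive degree.\<close>
  define w where "w = (1 + 2 * \<rho>) * norm (T 0)"
  have w: "0 \<le> w" using \<open>\<rho> > 0\<close> by (simp add: w_def)
  have radius: "cmod (cinner (T k v) v) \<le> w * (norm v)\<^sup>2" for k v
  proof (rule H.dense_induct [of "\<lambda>v. cmod (cinner (T k v) v) \<le> w * (norm v)\<^sup>2"])
    show "closed {v. cmod (cinner (T k v) v) \<le> w * (norm v)\<^sup>2}"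
      by (intro closed_Collect_le continuous_intros cinner.continuous_on)
    fix n :: nat and x y
    let ?v = "\<Sum>i<n. tH (x i) (y i)"
    interpret dilated_vector V F n "\<lambda>i. J (x i)" y by (fact dilated)
    have T0v: "cmod (cinner (T 0 ?v) ?v) \<le> norm (T 0) * (norm ?v)\<^sup>2"
    proof -
      have "cmod (cinner (T 0 ?v) ?v) \<le> norm (T 0 ?v) * norm ?v" by (rule cmod_cinner_le)
      also have "\<dots> \<le> norm (T 0) * norm ?v * norm ?v" by (intro mult_right_mono norm_blinfun) simp
      finally show ?thesis by (simp add: power2_eq_square mult.assoc)
    qed
    show "cmod (cinner (T k ?v) ?v) \<le> w * (norm ?v)\<^sup>2"
    proof (cases "k = 0")
      case True
      have "norm (T 0) * (norm ?v)\<^sup>2 \<le> w * (norm ?v)\<^sup>2"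
        unfolding w_def using \<open>\<rho> > 0\<close>
        by (intro mult_right_mono) (simp_all add: algebra_simps)
      with T0v True show ?thesis by simp
    next
      case False
      have "cmod (cinner (T k ?v) ?v) = \<rho> * cmod (moment 0 k)"
        using False \<open>\<rho> > 0\<close> by (simp add: moments [OF refl] norm_mult)
      also have "\<dots> \<le> \<rho> * (2 * Re (moment 0 0))"
        using False \<open>\<rho> > 0\<close> by (intro mult_left_mono off_diag_le) auto
      also have "\<dots> \<le> \<rho> * (2 * (norm (T 0) * (norm ?v)\<^sup>2))"
      proof -
        have "Re (moment 0 0) \<le> cmod (cinner (T 0 ?v) ?v)"
          by (simp add: moments [OF refl] complex_Re_le_cmod)
        with T0v have "Re (moment 0 0) \<le> norm (T 0) * (norm ?v)\<^sup>2" by linarith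
        then show ?thesis using \<open>\<rho> > 0\<close> by (intro mult_left_mono) auto
      qed
      also have "\<dots> \<le> w * (norm ?v)\<^sup>2"
        by (simp add: w_def algebra_simps)
      finally show ?thesis .
    qed
  qed
  have norm_T: "norm (T k) \<le> 2 * w" for k
    by (rule norm_le_numerical_radius [OF cT radius w])
  have norm_adj_T: "norm (adj (T k)) \<le> 2 * w" for k
  proof (rule norm_le_numerical_radius [OF clinear_adj [OF cT] _ w])
    show "cmod (cinner (adj (T k) v) v) \<le> w * (norm v)\<^sup>2" for v
      using radius [of k v] by (metis cinner_adj_left [OF cT] cinner_commute complex_mod_cnj)
  qed
  \<comment> \<open>Stated for a generic \<open>B\<close> to cover both the analytic half
    \<open>T\<close> and its adjoints, by comparison with a geometric series.\<close>
  have summable_T: "summable (\<lambda>k. (r ^ Suc k / 2) *\<^sub>R B (Suc k))"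
    if "\<And>k. norm (B k) \<le> 2 * w" for B :: "nat \<Rightarrow> 'he \<Rightarrow>\<^sub>L 'he"
  proof (rule summable_comparison_test')
    show "summable (\<lambda>k. w * r ^ Suc k)"
      using rr by (intro summable_mult summable_ignore_initial_segment [of "\<lambda>k. r ^ k" 1, simplified]
          summable_geometric) simp
    show "norm ((r ^ Suc k / 2) *\<^sub>R B (Suc k)) \<le> w * r ^ Suc k" for k
      using mult_left_mono [OF that [of "Suc k"], of "r ^ Suc k / 2"] rr by (simp add: mult_ac)
  qed
  define u where "u = free_pluriharm_eval tH A"
  have A_Suc: "tensor_op tH (word_op (\<lambda>i. r *\<^sub>R X i) \<gamma>) (A \<gamma>)
      = (r ^ length \<gamma> / 2) *\<^sub>R tensor_op tH (word_op X \<gamma>) (F \<gamma>)" if "\<gamma> \<noteq> []" for \<gamma>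
    using that
    by (intro H.tensor_op_unique) (simp add: blinfun.scaleR_left H.tensor_op_apply cX F word_op_scaleR
        A Re_coeff_def H.tensor.scaleR_left H.tensor.scaleR_right)
  have A_0: "tensor_op tH id_blinfun (A []) = (1/2) *\<^sub>R (adj (T 0) + T 0)"
  proof -
    have "adj id_blinfun = (id_blinfun :: 'h \<Rightarrow>\<^sub>L 'h)" by (rule adj_unique) simp
    then show ?thesis
      by (intro H.tensor_op_unique) (simp add: T0 A Re_coeff_def H.adj_tensor_op F
          blinfun.scaleR_left blinfun.add_left H.tensor_op_apply clinear_adj H.tensor.scaleR_right
          H.tensor.add_right)
  qed
  have cA: "A \<gamma> \<in> clinear_ops" for \<gamma>
    by (simp add: A Re_coeff_def clinear_scaleR clinear_add clinear_adj F)
  have holo: "(\<Sum>\<gamma> | length \<gamma> = Suc k. tensor_op tH (word_op (\<lambda>i. r *\<^sub>R X i) \<gamma>) (A \<gamma>))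
      = (r ^ Suc k / 2) *\<^sub>R T (Suc k)" for k
    unfolding T_def scaleR_sum_right by (intro sum.cong refl, subst A_Suc) auto
  have anti: "(\<Sum>\<gamma> | length \<gamma> = Suc k. tensor_op tH (adj (word_op (\<lambda>i. r *\<^sub>R X i) \<gamma>)) (adj (A \<gamma>)))
      = (r ^ Suc k / 2) *\<^sub>R adj (T (Suc k))" for k
  proof -
    have c: "word_op (\<lambda>i. r *\<^sub>R X i) \<gamma> \<in> clinear_ops" for \<gamma>
      by (intro clinear_word_op clinear_scaleR X)
    have "(\<Sum>\<gamma> | length \<gamma> = Suc k. tensor_op tH (adj (word_op (\<lambda>i. r *\<^sub>R X i) \<gamma>)) (adj (A \<gamma>)))
        = adj (\<Sum>\<gamma> | length \<gamma> = Suc k. tensor_op tH (word_op (\<lambda>i. r *\<^sub>R X i) \<gamma>) (A \<gamma>))"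
      by (simp add: adj_sum H.adj_tensor_op H.clinear_tensor_op c cA)
    then show ?thesis by (simp only: holo adj_scaleR [OF cT])
  qed
  have u_rX: "u (\<lambda>i. r *\<^sub>R X i) = (\<Sum>k. (r ^ Suc k / 2) *\<^sub>R adj (T (Suc k)))
      + (1/2) *\<^sub>R (adj (T 0) + T 0) + (\<Sum>k. (r ^ Suc k / 2) *\<^sub>R T (Suc k))"
    unfolding u_def free_pluriharm_eval_def holo anti A_0 ..
  have u_0: "u (\<lambda>i. 0) = (1/2) *\<^sub>R (adj (T 0) + T 0)"
  proof -
    have "word_op (\<lambda>i. 0 :: 'h \<Rightarrow>\<^sub>L 'h) \<gamma> = 0" if "length \<gamma> = Suc k" for \<gamma> :: "'n list" and k
      using that by (intro word_op_zero) auto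
    then show ?thesis unfolding u_def free_pluriharm_eval_def A_0 by simp
  qed
  have eval_rX: "cinner (u (\<lambda>i. r *\<^sub>R X i) v) v
      = of_real (Re (cinner (T 0 v) v) + (\<Sum>k. r ^ Suc k * Re (cinner (T (Suc k) v) v)))" for v
  proof -
    have bl: "bounded_linear (\<lambda>B :: 'he \<Rightarrow>\<^sub>L 'he. cinner (B v) v)"
      by (rule bounded_linear_compose [OF cinner.bounded_linear_left blinfun.bounded_linear_left])
    let ?z = "\<lambda>k. of_real (r ^ Suc k / 2) * cinner (T (Suc k) v) v"
    have sums1: "?z sums cinner ((\<Sum>k. (r ^ Suc k / 2) *\<^sub>R T (Suc k)) v) v"
      using bounded_linear.sums [OF bl summable_sums [OF summable_T [OF norm_T]]]
      by (simp only: blinfun.scaleR_left cinner.scaleR_left scaleR_conv_of_real)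
    have "cinner (adj (T k) v) v = cnj (cinner (T k v) v)" for k
      by (metis cinner_adj_left [OF cT] cinner_commute)
    then have sums2: "(\<lambda>k. of_real (r ^ Suc k / 2) * cnj (cinner (T (Suc k) v) v))
        sums cinner ((\<Sum>k. (r ^ Suc k / 2) *\<^sub>R adj (T (Suc k))) v) v"
      using bounded_linear.sums [OF bl summable_sums [OF summable_T [of "\<lambda>k. adj (T k)", OF norm_adj_T]]]
      by (simp only: blinfun.scaleR_left cinner.scaleR_left scaleR_conv_of_real)
    define g where "g k = r ^ Suc k * Re (cinner (T (Suc k) v) v)" for k
    define z where "z = cinner ((\<Sum>k. (r ^ Suc k / 2) *\<^sub>R adj (T (Suc k))) v) v
          + cinner ((\<Sum>k. (r ^ Suc k / 2) *\<^sub>R T (Suc k)) v) v"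
    \<comment> \<open>The two halves of the series are conjugate termwise, so the factors 1/2 add up
      to a real part.\<close>
    have "of_real (r ^ Suc k / 2) * cnj c + of_real (r ^ Suc k / 2) * c = of_real (r ^ Suc k * Re c)"
      for k c by (simp add: complex_eq_iff)
    with sums_add [OF sums2 sums1] have gz: "(\<lambda>k. complex_of_real (g k)) sums z"
      unfolding g_def z_def by (simp only:)
    then have gRe: "g sums Re z" using sums_Re by fastforce
    have "z = complex_of_real (Re z)"
      by (rule sums_unique2 [OF gz]) (simp only: sums_of_real_iff gRe)
    then have "z = of_real (\<Sum>k. g k)" using sums_unique [OF gRe] by simp
    then have "cinner ((\<Sum>k. (r ^ Suc k / 2) *\<^sub>R adj (T (Suc k))) v) v
        + cinner ((\<Sum>k. (r ^ Suc k / 2) *\<^sub>R T (Suc k)) v) v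
      = of_real (\<Sum>k. r ^ Suc k * Re (cinner (T (Suc k) v) v))"
      unfolding z_def g_def .
    then show ?thesis
      by (simp only: u_rX blinfun.add_left [of "_ + _"] blinfun.add_left [of "suminf _"]
          cinner.add_left cinner_Re_part [OF cT] of_real_add) (simp only: add_ac)
  qed
  \<comment> \<open>\<beta> is the quadratic form of u(0), and \<open>f\<close> is that of u(rV) at
    the dilated vector. All terms of positive degree are multiplied by \<rho>, which gives
    \<open>\<beta> + \<rho> * (f - \<beta>)\<close>.\<close>
  have bounds: "\<exists>\<beta> f. 0 \<le> \<beta> \<and> cinner (u (\<lambda>i. 0) v) v = of_real \<beta> \<and>
      cinner (u (\<lambda>i. r *\<^sub>R X i) v) v = of_real (\<beta> + \<rho> * (f - \<beta>)) \<and>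
      (1 - r) / (1 + r) * \<beta> \<le> f \<and> f \<le> (1 + r) / (1 - r) * \<beta>"
    if v: "v = (\<Sum>i<n. tH (x i) (y i))" for n :: nat and x y v
  proof -
    interpret dilated_vector V F n "\<lambda>i. J (x i)" y by (fact dilated)
    define f where "f = (\<Sum>l. r ^ l * Re (moment 0 l))"
    have sm: "summable (\<lambda>l. r ^ l * Re (moment 0 l))" by (rule summable_row [OF rr])
    have "(\<Sum>k. r ^ Suc k * Re (cinner (T (Suc k) v) v)) = (\<Sum>k. \<rho> * (r ^ Suc k * Re (moment 0 (Suc k))))"
      by (simp add: moments [OF v] mult_ac)
    also have "\<dots> = \<rho> * (\<Sum>k. r ^ Suc k * Re (moment 0 (Suc k)))"
      by (rule suminf_mult) (use sm in \<open>subst summable_Suc_iff\<close>)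
    also have "(\<Sum>k. r ^ Suc k * Re (moment 0 (Suc k))) = f - Re (moment 0 0)"
      using suminf_split_head [OF sm] by (simp add: f_def)
    finally have "cinner (u (\<lambda>i. r *\<^sub>R X i) v) v = of_real (Re (moment 0 0) + \<rho> * (f - Re (moment 0 0)))"
      by (simp only: eval_rX) (simp add: moments [OF v])
    moreover have "cinner (u (\<lambda>i. 0) v) v = of_real (Re (moment 0 0))"
      by (simp only: u_0 cinner_Re_part [OF cT]) (simp add: moments [OF v])
    ultimately show ?thesis using diag_nonneg [of 0] harnack [OF rr] unfolding f_def by blast
  qed
  have "op_le (((1 - r * (2 * \<rho> - 1)) / (1 + r)) *\<^sub>R u (\<lambda>i. 0)) (u (\<lambda>i. r *\<^sub>R X i))"
  proof (rule H.op_leI)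
    fix n :: nat and x y
    let ?v = "\<Sum>i<n. tH (x i) (y i)"
    obtain \<beta> f where \<beta>: "cinner (u (\<lambda>i. 0) ?v) ?v = of_real \<beta>"
      and f: "cinner (u (\<lambda>i. r *\<^sub>R X i) ?v) ?v = of_real (\<beta> + \<rho> * (f - \<beta>))"
      and le: "(1 - r) / (1 + r) * \<beta> \<le> f"
      using bounds [OF refl [of ?v]] by blast
    \<comment> \<open>The constant of the theorem is the image of the contraction constant
      \<open>(1 - r) / (1 + r)\<close> under the increasing affine map sending \<open>c\<close> to
      \<open>1 + \<rho> * (c - 1)\<close>.\<close>
    have "(1 - r * (2 * \<rho> - 1)) / (1 + r) * \<beta> = \<beta> + \<rho> * ((1 - r) / (1 + r) * \<beta> - \<beta>)"
      using rr by (simp add: field_simps)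
    also have "\<dots> \<le> \<beta> + \<rho> * (f - \<beta>)" using le \<open>\<rho> > 0\<close> by simp
    finally have "0 \<le> \<beta> + \<rho> * (f - \<beta>) - (1 - r * (2 * \<rho> - 1)) / (1 + r) * \<beta>" by simp
    moreover have "cinner ((u (\<lambda>i. r *\<^sub>R X i) - ((1 - r * (2 * \<rho> - 1)) / (1 + r)) *\<^sub>R u (\<lambda>i. 0)) ?v) ?v
        = of_real (\<beta> + \<rho> * (f - \<beta>) - (1 - r * (2 * \<rho> - 1)) / (1 + r) * \<beta>)"
      by (simp only: blinfun.diff_left blinfun.scaleR_left cinner.diff_left cinner.scaleR_left
          \<beta> f scaleR_conv_of_real of_real_diff of_real_mult)
    ultimately show "\<exists>c\<ge>0. cinner ((u (\<lambda>i. r *\<^sub>R X i)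
        - ((1 - r * (2 * \<rho> - 1)) / (1 + r)) *\<^sub>R u (\<lambda>i. 0)) ?v) ?v = complex_of_real c" by blast
  qed
  moreover have "op_le (u (\<lambda>i. r *\<^sub>R X i)) (((1 + r * (2 * \<rho> - 1)) / (1 - r)) *\<^sub>R u (\<lambda>i. 0))"
  proof (rule H.op_leI)
    fix n :: nat and x y
    let ?v = "\<Sum>i<n. tH (x i) (y i)"
    obtain \<beta> f where \<beta>: "cinner (u (\<lambda>i. 0) ?v) ?v = of_real \<beta>"
      and f: "cinner (u (\<lambda>i. r *\<^sub>R X i) ?v) ?v = of_real (\<beta> + \<rho> * (f - \<beta>))"
      and le: "f \<le> (1 + r) / (1 - r) * \<beta>"
      using bounds [OF refl [of ?v]] by blast
    have "\<beta> + \<rho> * (f - \<beta>) \<le> \<beta> + \<rho> * ((1 + r) / (1 - r) * \<beta> - \<beta>)" using le \<open>\<rho> > 0\<close> by simp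
    also have "\<dots> = (1 + r * (2 * \<rho> - 1)) / (1 - r) * \<beta>"
      using rr by (simp add: field_simps)
    finally have "0 \<le> (1 + r * (2 * \<rho> - 1)) / (1 - r) * \<beta> - (\<beta> + \<rho> * (f - \<beta>))" by simp
    moreover have "cinner ((((1 + r * (2 * \<rho> - 1)) / (1 - r)) *\<^sub>R u (\<lambda>i. 0) - u (\<lambda>i. r *\<^sub>R X i)) ?v) ?v
        = of_real ((1 + r * (2 * \<rho> - 1)) / (1 - r) * \<beta> - (\<beta> + \<rho> * (f - \<beta>)))"
      by (simp only: blinfun.diff_left blinfun.scaleR_left cinner.diff_left cinner.scaleR_left
          \<beta> f scaleR_conv_of_real of_real_diff of_real_mult)
    ultimately show "\<exists>c\<ge>0. cinner ((((1 + r * (2 * \<rho> - 1)) / (1 - r)) *\<^sub>R u (\<lambda>i. 0)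
        - u (\<lambda>i. r *\<^sub>R X i)) ?v) ?v = complex_of_real c" by blast
  qed
  ultimately show ?thesis by (simp add: u_def Let_def)
qed

end
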